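(* For every integer $d \geq 1$ there exist constants $C_d, C_d' > 0$ such that the following holds. Let $V \subset \mathbb{C}^d$ be a set of $n$ points and let $r \geq 2$ be an integer. Suppose that for some real $\alpha \geq 1$, $$|\mathcal{L}_r(V)| \geq C_d \cdot \alpha \cdot \frac{n^2}{r^d}.$$ Then there exists a subset $\tilde V \subset V$ of size at least $C_d' \cdot \alpha \cdot \frac{n}{r^{d-2}}$ that is contained in a $(d-1)$-flat. Moreover, there are absolute constants $c, c' > 0$ (independent of $d$) such that one can take $C_d = d^{cd}$ and $C_d' = d^{c'd}$.
   Context: For a finite set $V \subset \mathbb{C}^d$ and an integer $r \geq 2$, $\mathcal{L}_r(V)$ denotes the set of $r$-rich lines of $V$, i.e. the set of (complex affine) lines in $\mathbb{C}^d$ that contain at least $r$ points of $V$. An $\ell$-flat is an $\ell$-dimensional complex affine subspace of $\mathbb{C}^d$ (so a $(d-1)$-flat is an affine hyperplane). *)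

theory Defs
  imports Complex_Main "Jordan_Normal_Form.VS_Connect"
begin

(* C^d is carrier_vec d; the record update turns a linear subspace W of it into
   a vector space in its own right, so that its dimension over the complex
   numbers can be taken. *)
definition is_flat :: "nat \<Rightarrow> nat \<Rightarrow> complex vec set \<Rightarrow> bool" where
  "is_flat d l F \<longleftrightarrow>
     (\<exists>p \<in> carrier_vec d. \<exists>W.
        VectorSpace.subspace class_ring W (module_vec TYPE(complex) d) \<and>
        vectorspace.dim class_ring (module_vec TYPE(complex) d\<lparr>carrier := W\<rparr>) = l \<and>
        F = (\<lambda>w. p + w) ` W)"

(* Intended for finite V and r >= 2: then the set of rich lines is finite, and
   neither use of card (here and on the set itself) hits an infinite set. *)
definition rich_lines :: "nat \<Rightarrow> nat \<Rightarrow> complex vec set \<Rightarrow> complex vec set set" where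
  "rich_lines d r V = {L. is_flat d 1 L \<and> r \<le> card (L \<inter> V)}"

(* The constants C and C' are admissible in dimension d. The exponent d - 2 is
   an integer one: for d = 1 the bound reads C' * alpha * n * r. *)
definition rich_lines_constants :: "nat \<Rightarrow> real \<Rightarrow> real \<Rightarrow> bool" where
  "rich_lines_constants d C C' \<longleftrightarrow>
     (\<forall>V n r. \<forall>\<alpha>::real.
        V \<subseteq> carrier_vec d \<and> finite V \<and> card V = n \<and> r \<ge> 2 \<and> \<alpha> \<ge> 1 \<and>
        real (card (rich_lines d r V)) \<ge> C * \<alpha> * (real n ^ 2 / real r ^ d) \<longrightarrow>
        (\<exists>V' \<subseteq> V.
           real (card V') \<ge> C' * \<alpha> * (real n / real r powi (int d - 2)) \<and>
           (\<exists>F. is_flat d (d - 1) F \<and> V' \<subseteq> F)))"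

end

(* Following Dvir and Gopi, pass to a subset A of V and a set B of rich lines such that every
   line of B still has at least r/4 points of A and every point of A lies on many lines of B.
   Polynomials of degree D < |line \<inter> A| satisfy, on each line, a linear relation between their values
   at D + 2 points. These local relations form a sparse matrix whose supports meet pairwise
   rarely, and after rescaling rows and columns it satisfies B* B = k I + (small), so it has large rank
   (Barak, Dvir, Wigderson and Yehudayoff). Hence the space of polynomials restricted
   to A has small dimension, and some nonzero polynomial of degree at most D vanishes on A. Take one of
   least degree: its gradient is nonzero at some p in A, while the polynomial itself vanishes on all lines of B,
   so all lines of B through p lie in its tangent hyperplane at p. *)

theory Submission
  imports Defs
begin

section \<open>Scaling and the rank of design matrices\<close>

text \<open>The exponent d in n^2 / r^d comes from a dimension count. There are (e + 1)^d monomials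
  with all exponents at most e, and their degree is at most d e; so e may be about r / (4 d) when
  every line keeps r / 4 points. If no nontrivial combination of them vanished on A, the rank bound
  would give (e + 1)^d k \<le> r |A|, where k, the number of lines available at each point, is about
  r m / (4 n) for m rich lines and n points. This fails once m exceeds 4 (8 d)^d n^2 / r^d. The
  hyperplane at p then contains k lines with r - 1 further points each. That count grows linearly in
  m, which is how \<alpha> reaches the conclusion. The obstacle in the rank bound is that the ideal
  scaling, with rows of norm 1 and equal column norms, may exist only in the limit. Hence columns
  are balanced up to an arbitrary \<epsilon>, and the integrality of the final inequality absorbs
  the error.\<close>

lemma exp_le_quadratic:
  fixes s :: real
  assumes "\<bar>s\<bar> \<le> 1"
  shows "exp s \<le> 1 + s + s\<^sup>2"
proof (cases "s \<ge> 0")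
  case True
  then show ?thesis using exp_bound[of s] assms by auto
next
  case False
  \<comment> \<open>The product equals 1 - s^3, and s is negative.\<close>
  have "1 \<le> (1 + s + s\<^sup>2) * (1 - s)"
    using False mult_nonpos_nonneg[of s "s * s"]
    by (simp add: algebra_simps power2_eq_square)
  also have "\<dots> \<le> (1 + s + s\<^sup>2) * exp (- s)"
    using exp_ge_add_one_self[of "- s"] assms False
    by (intro mult_left_mono) auto
  finally show ?thesis
    by (simp add: exp_minus field_simps)
qed

text \<open>A near-minimiser of the convex function \<open>F\<close> is nearly critical, and the partial derivatives
  of \<open>F\<close> are the defects of the column sums. The entries \<open>w \<rho> (\<pi> \<rho>) = 1\<close> make \<open>F\<close> bounded below.\<close>
lemma row_column_scaling:
  fixes w :: "'r \<Rightarrow> 'j \<Rightarrow> real" and \<pi> :: "'r \<Rightarrow> 'j"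
  assumes J: "finite J" and R: "finite R"
    and w: "\<And>\<rho> j. w \<rho> j \<ge> 0"
    and \<pi>: "\<And>\<rho>. \<rho> \<in> R \<Longrightarrow> \<pi> \<rho> \<in> J" "\<And>\<rho>. \<rho> \<in> R \<Longrightarrow> w \<rho> (\<pi> \<rho>) = 1"
    and k: "\<And>j. j \<in> J \<Longrightarrow> card {\<rho> \<in> R. \<pi> \<rho> = j} = k"
    and \<epsilon>: "\<epsilon> > 0"
  obtains y :: "'j \<Rightarrow> real" where
    "\<And>j. j \<in> J \<Longrightarrow>
       \<bar>(\<Sum>\<rho>\<in>R. w \<rho> j * exp (y j) / (\<Sum>i\<in>J. w \<rho> i * exp (y i))) - real k\<bar> \<le> \<epsilon>"
proof -
  define S where "S = (\<lambda>(y :: 'j \<Rightarrow> real) \<rho>. \<Sum>i\<in>J. w \<rho> i * exp (y i))"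
  define F where "F = (\<lambda>y. \<Sum>\<rho>\<in>R. ln (S y \<rho>) - y (\<pi> \<rho>))"
  have S_ge: "exp (y (\<pi> \<rho>)) \<le> S y \<rho>" if "\<rho> \<in> R" for y \<rho>
    using member_le_sum[of "\<pi> \<rho>" J "\<lambda>i. w \<rho> i * exp (y i)"] J w \<pi> that
    by (auto simp: S_def)
  have S_pos: "S y \<rho> > 0" if "\<rho> \<in> R" for y \<rho>
    using S_ge[OF that, of y] exp_gt_zero[of "y (\<pi> \<rho>)"] by linarith
  have F_nonneg: "F y \<ge> 0" for y
    unfolding F_def
  proof (rule sum_nonneg)
    fix \<rho> assume "\<rho> \<in> R"
    then show "0 \<le> ln (S y \<rho>) - y (\<pi> \<rho>)"
      using S_ge[of \<rho> y] S_pos[of \<rho> y] by (simp add: ln_ge_iff)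
  qed
  define M where "M = real (card R)"
  \<comment> \<open>\<open>\<eta>\<close> is the length of a move along one coordinate,
    \<open>\<delta>\<close> the distance from the infimum, which need not be attained. Dividing the
    inequality \<open>step\<close> by \<open>\<eta>\<close> leaves the errors
    \<open>\<delta> / \<eta> = \<epsilon> / 2\<close> and \<open>P * \<eta>\<close>, where the
    column sum \<open>P\<close> is at most \<open>M\<close>.\<close>
  define \<eta> where "\<eta> = min 1 (\<epsilon> / (2 * (M + 1)))"
  define \<delta> where "\<delta> = \<eta> * \<epsilon> / 2"
  have M: "M \<ge> 0" by (simp add: M_def)
  have \<eta>: "0 < \<eta>" "\<eta> \<le> 1" using \<epsilon> M by (auto simp: \<eta>_def)
  have "M * \<eta> \<le> M * (\<epsilon> / (2 * (M + 1)))"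
    using M by (intro mult_left_mono) (auto simp: \<eta>_def)
  also have "\<dots> \<le> \<epsilon> / 2"
    using M \<epsilon> by (simp add: field_simps)
  finally have M\<eta>: "M * \<eta> \<le> \<epsilon> / 2" .
  have \<delta>: "\<delta> > 0" using \<eta> \<epsilon> by (simp add: \<delta>_def)
  have bdd: "bdd_below (range F)"
    using F_nonneg by (intro bdd_belowI[of _ 0]) auto
  obtain y where y: "F y < Inf (range F) + \<delta>"
    using cInf_lessD[of "range F" "Inf (range F) + \<delta>"] \<delta> by auto
  have near_min: "F y - \<delta> \<le> F z" for z
    using y cInf_lower[OF _ bdd, of "F z"] by auto
  define p where "p = (\<lambda>\<rho> j. w \<rho> j * exp (y j) / S y \<rho>)"
  have p: "0 \<le> p \<rho> j" "p \<rho> j \<le> 1" if "\<rho> \<in> R" "j \<in> J" for \<rho> j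
  proof -
    show "0 \<le> p \<rho> j" using w S_pos[OF that(1), of y] by (simp add: p_def)
    have "w \<rho> j * exp (y j) \<le> S y \<rho>"
      unfolding S_def using that J w by (intro member_le_sum) auto
    then show "p \<rho> j \<le> 1" using S_pos[OF that(1), of y] by (simp add: p_def)
  qed
  \<comment> \<open>Moving coordinate \<open>j\<close> by \<open>s\<close> multiplies each row sum
    by \<open>1 + p \<rho> j * (exp s - 1)\<close>, and the linear part of \<open>F\<close> changes
    by \<open>k * s\<close> since exactly \<open>k\<close> rows have
    \<open>\<pi> \<rho> = j\<close>. To first order the change is (column sum - k) s; signs +\<eta>
    and -\<eta> bound the defect from both sides.\<close>
  have step: "- \<delta> \<le> (\<Sum>\<rho>\<in>R. p \<rho> j) * (s + s\<^sup>2) - real k * s"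
    if j: "j \<in> J" and s: "\<bar>s\<bar> \<le> 1" for j s
  proof -
    define z where "z = y(j := y j + s)"
    have Sz: "S z \<rho> = S y \<rho> * (1 + p \<rho> j * (exp s - 1))" if "\<rho> \<in> R" for \<rho>
    proof -
      have "S z \<rho> = w \<rho> j * exp (y j + s) + (\<Sum>i\<in>J - {j}. w \<rho> i * exp (y i))"
        unfolding S_def using J j by (simp add: sum.remove z_def)
      moreover have "S y \<rho> = w \<rho> j * exp (y j) + (\<Sum>i\<in>J - {j}. w \<rho> i * exp (y i))"
        unfolding S_def using J j by (simp add: sum.remove)
      ultimately have "S z \<rho> = S y \<rho> + w \<rho> j * exp (y j) * (exp s - 1)"
        by (simp add: exp_add algebra_simps)
      also have "w \<rho> j * exp (y j) = S y \<rho> * p \<rho> j"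
        using S_pos[OF that, of y] by (simp add: p_def)
      finally show ?thesis by (simp add: algebra_simps)
    qed
    have ln_le: "ln (S z \<rho>) \<le> ln (S y \<rho>) + p \<rho> j * (s + s\<^sup>2)" if \<rho>: "\<rho> \<in> R" for \<rho>
    proof -
      have pos: "1 + p \<rho> j * (exp s - 1) > 0"
        using Sz[OF \<rho>] S_pos[OF \<rho>, of y] S_pos[OF \<rho>, of z] by (simp add: zero_less_mult_iff)
      have "ln (S z \<rho>) = ln (S y \<rho>) + ln (1 + p \<rho> j * (exp s - 1))"
        using pos S_pos[OF \<rho>, of y] by (simp add: Sz[OF \<rho>] ln_mult_pos)
      moreover have "ln (1 + p \<rho> j * (exp s - 1)) \<le> p \<rho> j * (exp s - 1)"
        using ln_le_minus_one[OF pos] by simp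
      moreover have "p \<rho> j * (exp s - 1) \<le> p \<rho> j * (s + s\<^sup>2)"
        using p[OF \<rho> j] exp_le_quadratic[OF s] by (intro mult_left_mono) auto
      ultimately show ?thesis by linarith
    qed
    have "(\<Sum>\<rho>\<in>R. z (\<pi> \<rho>) - y (\<pi> \<rho>)) = (\<Sum>\<rho>\<in>R. if \<pi> \<rho> = j then s else 0)"
      by (rule sum.cong) (auto simp: z_def)
    also have "\<dots> = real k * s"
      using R k[OF j] by (simp flip: sum.inter_filter)
    finally have shift: "(\<Sum>\<rho>\<in>R. z (\<pi> \<rho>)) = (\<Sum>\<rho>\<in>R. y (\<pi> \<rho>)) + real k * s"
      by (simp add: sum_subtractf)
    have "(\<Sum>\<rho>\<in>R. ln (S z \<rho>)) \<le> (\<Sum>\<rho>\<in>R. ln (S y \<rho>) + p \<rho> j * (s + s\<^sup>2))"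
      by (intro sum_mono ln_le)
    then have "F z \<le> F y + (\<Sum>\<rho>\<in>R. p \<rho> j) * (s + s\<^sup>2) - real k * s"
      using shift by (simp add: F_def sum_subtractf sum.distrib sum_distrib_right)
    then show ?thesis using near_min[of z] by linarith
  qed
  have "\<bar>(\<Sum>\<rho>\<in>R. p \<rho> j) - real k\<bar> \<le> \<epsilon>" if j: "j \<in> J" for j
  proof -
    define P where "P = (\<Sum>\<rho>\<in>R. p \<rho> j)"
    have "P \<le> M"
      using sum_mono[of R "\<lambda>\<rho>. p \<rho> j" "\<lambda>_. 1"] p j by (simp add: P_def M_def)
    then have P\<eta>: "P * \<eta> \<le> \<epsilon> / 2"
      using M\<eta> \<eta> mult_right_mono[of P M \<eta>] by linarith
    have "- \<delta> \<le> \<eta> * ((P - real k) + P * \<eta>)"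
      using step[OF j, of \<eta>] \<eta> by (simp add: P_def algebra_simps power2_eq_square)
    then have "\<eta> * (- (\<epsilon> / 2)) \<le> \<eta> * ((P - real k) + P * \<eta>)"
      by (simp add: \<delta>_def)
    then have lower: "- (\<epsilon> / 2) \<le> (P - real k) + P * \<eta>"
      using \<eta> mult_le_cancel_left_pos by blast
    have "- \<delta> \<le> \<eta> * (- (P - real k) + P * \<eta>)"
      using step[OF j, of "- \<eta>"] \<eta> by (simp add: P_def algebra_simps power2_eq_square)
    then have "\<eta> * (- (\<epsilon> / 2)) \<le> \<eta> * (- (P - real k) + P * \<eta>)"
      by (simp add: \<delta>_def)
    then have upper: "- (\<epsilon> / 2) \<le> - (P - real k) + P * \<eta>"
      using \<eta> mult_le_cancel_left_pos by blast
    show ?thesis using lower upper P\<eta> unfolding P_def by linarith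
  qed
  then show thesis
    using that[of y] by (simp add: p_def S_def)
qed

section \<open>Orthonormal systems, Bessel's inequality and the rank bound\<close>

lemma underdetermined_system:
  fixes a :: "nat \<Rightarrow> nat \<Rightarrow> 'a :: field"
  assumes "q < N"
  obtains c where "\<exists>i<N. c i \<noteq> 0" "\<And>l. l < q \<Longrightarrow> (\<Sum>i<N. c i * a l i) = 0"
proof -
  \<comment> \<open>The zero row at index \<open>q\<close> makes the square matrix singular. The
    rows after it only impose further equations on the kernel vector.\<close>
  define A where "A = mat\<^sub>r N N (\<lambda>l. if l = q then 0\<^sub>v N else vec N (a l))"
  have A: "A \<in> carrier_mat N N" by (auto simp: A_def)
  have "det A = 0"
    unfolding A_def by (rule det_row_0[OF assms]) auto
  then obtain v where v: "v \<in> carrier_vec N" "v \<noteq> 0\<^sub>v N" "A *\<^sub>v v = 0\<^sub>v N"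
    using det_0_iff_vec_prod_zero_field[OF A] by auto
  show thesis
  proof (rule that[of "\<lambda>i. v $ i"])
    show "\<exists>i<N. v $ i \<noteq> 0"
      using v(1,2) by (metis carrier_vecD eq_vecI index_zero_vec)
  next
    fix l assume "l < q"
    then have "(\<Sum>i<N. v $ i * a l i) = (A *\<^sub>v v) $ l"
      using assms v(1) by (simp add: A_def scalar_prod_def lessThan_atLeast0 mult.commute)
    then show "(\<Sum>i<N. v $ i * a l i) = 0"
      using v(3) \<open>l < q\<close> assms by simp
  qed
qed

text \<open>Instead of subtracting projections, each new vector is a nontrivial combination of all
  \<open>\<Phi> l\<close> that is orthogonal to the \<open>q\<close> earlier ones: \<open>q\<close>
  equations in \<open>N > q\<close> unknowns. Independence on \<open>J\<close> makes its norm
  nonzero, so it can be normalised.\<close>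

lemma orthonormal_system_exists:
  fixes \<Phi> :: "nat \<Rightarrow> 'j \<Rightarrow> complex"
  assumes J: "finite J"
    and indep: "\<And>c i. (\<And>j. j \<in> J \<Longrightarrow> (\<Sum>l<N. c l * \<Phi> l j) = 0) \<Longrightarrow> i < N \<Longrightarrow> c i = 0"
  shows "q \<le> N \<Longrightarrow> \<exists>\<psi>.
     (\<forall>i<q. \<exists>c. \<forall>j\<in>J. \<psi> i j = (\<Sum>l<N. c l * \<Phi> l j)) \<and>
     (\<forall>i<q. \<forall>l<q. (\<Sum>j\<in>J. \<psi> i j * cnj (\<psi> l j)) = (if i = l then 1 else 0))"
proof (induction q)
  case 0
  then show ?case by simp
next
  case (Suc q)
  then have "q \<le> N" by simp
  from Suc.IH[OF this] obtain \<psi> where span: "\<forall>i<q. \<exists>c. \<forall>j\<in>J. \<psi> i j = (\<Sum>l<N. c l * \<Phi> l j)"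
    and on: "\<forall>i<q. \<forall>l<q. (\<Sum>j\<in>J. \<psi> i j * cnj (\<psi> l j)) = (if i = l then 1 else 0)"
    by (elim exE conjE) (rule that)
  obtain c where c: "\<exists>i<N. c i \<noteq> 0"
    and c_orth: "\<And>l. l < q \<Longrightarrow> (\<Sum>i<N. c i * (\<Sum>j\<in>J. \<Phi> i j * cnj (\<psi> l j))) = 0"
    using underdetermined_system[of q N "\<lambda>l i. \<Sum>j\<in>J. \<Phi> i j * cnj (\<psi> l j)"] Suc.prems by auto
  define \<phi> where "\<phi> = (\<lambda>j. \<Sum>i<N. c i * \<Phi> i j)"
  define s where "s = (\<Sum>j\<in>J. (cmod (\<phi> j))\<^sup>2)"
  have orth: "(\<Sum>j\<in>J. \<phi> j * cnj (\<psi> l j)) = 0" if "l < q" for l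
  proof -
    have "(\<Sum>j\<in>J. \<phi> j * cnj (\<psi> l j)) = (\<Sum>j\<in>J. \<Sum>i<N. c i * (\<Phi> i j * cnj (\<psi> l j)))"
      by (simp add: \<phi>_def sum_distrib_right mult.assoc)
    also have "\<dots> = (\<Sum>i<N. c i * (\<Sum>j\<in>J. \<Phi> i j * cnj (\<psi> l j)))"
      by (subst sum.swap) (simp add: sum_distrib_left)
    finally show ?thesis using c_orth[OF that] by simp
  qed
  have orth': "(\<Sum>j\<in>J. \<psi> l j * cnj (\<phi> j)) = 0" if "l < q" for l
    using arg_cong[OF orth[OF that], of cnj]
    by (simp only: cnj_sum complex_cnj_mult complex_cnj_cnj complex_cnj_zero mult.commute)
  have "s \<noteq> 0"
  proof
    assume "s = 0"
    then have "\<phi> j = 0" if "j \<in> J" for j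
      using that J by (simp add: s_def sum_nonneg_eq_0_iff)
    then have "(\<Sum>l<N. c l * \<Phi> l j) = 0" if "j \<in> J" for j
      using that by (simp add: \<phi>_def)
    then show False using indep c by blast
  qed
  moreover have "s \<ge> 0" by (simp add: s_def sum_nonneg)
  ultimately have s: "s > 0" by simp
  define \<chi> where "\<chi> = (\<lambda>j. \<phi> j / complex_of_real (sqrt s))"
  have ss: "complex_of_real (sqrt s) * complex_of_real (sqrt s) = complex_of_real s"
    using s by (simp flip: of_real_mult)
  have norm1: "(\<Sum>j\<in>J. \<chi> j * cnj (\<chi> j)) = 1"
  proof -
    have "(\<Sum>j\<in>J. \<chi> j * cnj (\<chi> j)) = (\<Sum>j\<in>J. complex_of_real ((cmod (\<phi> j))\<^sup>2) / complex_of_real s)"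
      by (rule sum.cong) (simp_all only: \<chi>_def complex_cnj_divide complex_cnj_complex_of_real
          times_divide_times_eq ss complex_norm_square)
    also have "\<dots> = complex_of_real s / complex_of_real s"
      by (simp add: s_def flip: sum_divide_distrib)
    finally show ?thesis using s by simp
  qed
  have o1: "(\<Sum>j\<in>J. \<chi> j * cnj (\<psi> l j)) = 0" "(\<Sum>j\<in>J. \<psi> l j * cnj (\<chi> j)) = 0"
    if "l < q" for l
    using orth[OF that] orth'[OF that] by (simp_all add: \<chi>_def flip: sum_divide_distrib)
  have span1: "\<exists>d. \<forall>j\<in>J. \<chi> j = (\<Sum>l<N. d l * \<Phi> l j)"
    by (rule exI[of _ "\<lambda>l. c l / complex_of_real (sqrt s)"])
      (simp add: \<chi>_def \<phi>_def sum_divide_distrib)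
  show ?case
    by (rule exI[of _ "\<psi>(q := \<chi>)"]) (use span on span1 o1 norm1 in \<open>auto simp: less_Suc_eq\<close>)
qed

text \<open>The pairing carries no conjugate because \<open>e\<close> will be a row of a matrix
  applied to \<open>\<psi> i\<close>. The conjugates of the \<open>\<psi> i\<close> are orthonormal
  too, \<open>u\<close> is the projection of \<open>e\<close> onto their span, and the inequality is
  nonnegativity of the squared norm of \<open>e - u\<close>.\<close>

lemma Bessel_sum:
  fixes \<psi> :: "nat \<Rightarrow> 'j \<Rightarrow> complex"
  assumes on: "\<And>i l. i < q \<Longrightarrow> l < q \<Longrightarrow>
        (\<Sum>j\<in>J. \<psi> i j * cnj (\<psi> l j)) = (if i = l then 1 else 0)"
  shows "(\<Sum>i<q. (cmod (\<Sum>j\<in>J. e j * \<psi> i j))\<^sup>2) \<le> (\<Sum>j\<in>J. (cmod (e j))\<^sup>2)"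
proof -
  define t where "t = (\<lambda>i. \<Sum>j\<in>J. e j * \<psi> i j)"
  define u where "u = (\<lambda>j. \<Sum>i<q. t i * cnj (\<psi> i j))"
  define T where "T = (\<Sum>i<q. t i * cnj (t i))"
  have cnj_u: "cnj (u j) = (\<Sum>i<q. cnj (t i) * \<psi> i j)" for j
    by (simp add: u_def)
  have eu: "(\<Sum>j\<in>J. e j * cnj (u j)) = T"
  proof -
    have "(\<Sum>j\<in>J. e j * cnj (u j)) = (\<Sum>j\<in>J. \<Sum>i<q. cnj (t i) * (e j * \<psi> i j))"
      by (simp add: cnj_u sum_distrib_left ac_simps)
    also have "\<dots> = (\<Sum>i<q. cnj (t i) * t i)"
      by (subst sum.swap) (simp add: t_def sum_distrib_left)
    finally show ?thesis by (simp add: T_def mult.commute)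
  qed
  have ue: "(\<Sum>j\<in>J. u j * cnj (e j)) = T"
    using arg_cong[OF eu, of cnj] by (simp add: T_def mult.commute)
  have uu: "(\<Sum>j\<in>J. u j * cnj (u j)) = T"
  proof -
    have "(\<Sum>j\<in>J. u j * cnj (u j)) =
        (\<Sum>j\<in>J. \<Sum>l<q. \<Sum>i<q. t l * cnj (t i) * (\<psi> i j * cnj (\<psi> l j)))"
      unfolding cnj_u by (simp add: u_def sum_product ac_simps)
    also have "\<dots> = (\<Sum>l<q. \<Sum>i<q. \<Sum>j\<in>J. t l * cnj (t i) * (\<psi> i j * cnj (\<psi> l j)))"
      by (subst sum.swap, intro sum.cong refl, subst sum.swap, simp)
    also have "\<dots> = (\<Sum>l<q. \<Sum>i<q. if i = l then t l * cnj (t i) else 0)"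
      by (intro sum.cong refl) (simp add: on flip: sum_distrib_left)
    also have "\<dots> = T" by (simp add: T_def)
    finally show ?thesis .
  qed
  have "complex_of_real (\<Sum>j\<in>J. (cmod (e j - u j))\<^sup>2) =
      (\<Sum>j\<in>J. e j * cnj (e j) - e j * cnj (u j) - u j * cnj (e j) + u j * cnj (u j))"
    by (simp add: complex_norm_square algebra_simps del: of_real_power)
  also have "\<dots> = (\<Sum>j\<in>J. e j * cnj (e j)) - T"
    by (simp add: sum.distrib sum_subtractf eu ue uu)
  also have "\<dots> = complex_of_real ((\<Sum>j\<in>J. (cmod (e j))\<^sup>2) - (\<Sum>i<q. (cmod (t i))\<^sup>2))"
    by (simp add: T_def complex_norm_square del: of_real_power)
  finally have "(\<Sum>j\<in>J. (cmod (e j - u j))\<^sup>2) =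
      (\<Sum>j\<in>J. (cmod (e j))\<^sup>2) - (\<Sum>i<q. (cmod (t i))\<^sup>2)"
    using of_real_eq_iff by blast
  moreover have "0 \<le> (\<Sum>j\<in>J. (cmod (e j - u j))\<^sup>2)" by (simp add: sum_nonneg)
  ultimately show ?thesis by (simp add: t_def)
qed

text \<open>Each \<open>\<psi> i\<close> is stretched by \<open>\<mu>\<close>, so the left side is
  the sum of the squared norms of the images of the \<open>\<psi> i\<close>. Bessel's inequality
  bounds the contribution of each row of \<open>E\<close> to that sum.\<close>

lemma eigenspace_dim_le_Frobenius:
  fixes \<psi> :: "nat \<Rightarrow> 'j \<Rightarrow> complex" and E :: "'j \<Rightarrow> 'j \<Rightarrow> complex"
  assumes on: "\<And>i l. i < q \<Longrightarrow> l < q \<Longrightarrow>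
        (\<Sum>j\<in>J. \<psi> i j * cnj (\<psi> l j)) = (if i = l then 1 else 0)"
    and eig: "\<And>i j. i < q \<Longrightarrow> j \<in> J \<Longrightarrow> (\<Sum>l\<in>J. E j l * \<psi> i l) = \<mu> * \<psi> i j"
  shows "real q * (cmod \<mu>)\<^sup>2 \<le> (\<Sum>j\<in>J. \<Sum>l\<in>J. (cmod (E j l))\<^sup>2)"
proof -
  have one: "(\<Sum>j\<in>J. (cmod (\<psi> i j))\<^sup>2) = 1" if "i < q" for i
  proof -
    have "complex_of_real (\<Sum>j\<in>J. (cmod (\<psi> i j))\<^sup>2) = 1"
      using on[OF that that] by (simp add: complex_norm_square del: of_real_power)
    then show ?thesis using of_real_eq_1_iff by blast
  qed
  have "real q * (cmod \<mu>)\<^sup>2 = (\<Sum>i<q. (cmod \<mu>)\<^sup>2 * (\<Sum>j\<in>J. (cmod (\<psi> i j))\<^sup>2))"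
    by (simp add: one)
  also have "\<dots> = (\<Sum>j\<in>J. \<Sum>i<q. (cmod (\<Sum>l\<in>J. E j l * \<psi> i l))\<^sup>2)"
    by (subst sum.swap) (simp add: eig norm_mult power_mult_distrib sum_distrib_left)
  also have "\<dots> \<le> (\<Sum>j\<in>J. \<Sum>l\<in>J. (cmod (E j l))\<^sup>2)"
    by (intro sum_mono Bessel_sum on)
  finally show ?thesis .
qed

text \<open>Cauchy-Schwarz against the all-ones vector, from the variance of the moduli. It turns
  the number of rows common to two columns into the factor \<open>t\<close> of the rank
  bound.\<close>

lemma norm_sum_power2_le:
  fixes z :: "'r \<Rightarrow> complex"
  assumes "finite X"
  shows "(cmod (\<Sum>\<rho>\<in>X. z \<rho>))\<^sup>2 \<le> real (card X) * (\<Sum>\<rho>\<in>X. (cmod (z \<rho>))\<^sup>2)"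
proof (cases "X = {}")
  case False
  define c where "c = real (card X)"
  define T where "T = (\<Sum>\<rho>\<in>X. cmod (z \<rho>))"
  have c: "c > 0" using False assms by (simp add: c_def card_gt_0_iff)
  have "0 \<le> (\<Sum>\<rho>\<in>X. (c * cmod (z \<rho>) - T)\<^sup>2)" by (simp add: sum_nonneg)
  also have "\<dots> = (\<Sum>\<rho>\<in>X. c\<^sup>2 * (cmod (z \<rho>))\<^sup>2 - 2 * c * T * cmod (z \<rho>) + T\<^sup>2)"
    by (intro sum.cong refl) (simp add: algebra_simps power2_eq_square)
  also have "\<dots> = c\<^sup>2 * (\<Sum>\<rho>\<in>X. (cmod (z \<rho>))\<^sup>2) - 2 * c * T * T + c * T\<^sup>2"
    by (simp add: sum.distrib sum_subtractf c_def sum_distrib_left T_def)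
  also have "\<dots> = c * (c * (\<Sum>\<rho>\<in>X. (cmod (z \<rho>))\<^sup>2) - T\<^sup>2)"
    by (simp add: algebra_simps power2_eq_square)
  finally have "T\<^sup>2 \<le> c * (\<Sum>\<rho>\<in>X. (cmod (z \<rho>))\<^sup>2)"
    using c by (simp add: zero_le_mult_iff)
  moreover have "(cmod (\<Sum>\<rho>\<in>X. z \<rho>))\<^sup>2 \<le> T\<^sup>2"
    unfolding T_def by (intro power_mono norm_sum) simp
  ultimately show ?thesis by (simp add: c_def)
qed auto

text \<open>\<open>E = B* B - k I\<close> acts as \<open>- k\<close> on the scaled kernel, while its Frobenius norm is small.\<close>
theorem design_rank_bound:
  fixes a :: "'r \<Rightarrow> 'j \<Rightarrow> complex" and \<pi> :: "'r \<Rightarrow> 'j" and \<Phi> :: "nat \<Rightarrow> 'j \<Rightarrow> complex"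
  assumes J: "finite J" and R: "finite R"
    and \<pi>: "\<And>\<rho>. \<rho> \<in> R \<Longrightarrow> \<pi> \<rho> \<in> J" "\<And>\<rho>. \<rho> \<in> R \<Longrightarrow> a \<rho> (\<pi> \<rho>) = 1"
    and k: "\<And>j. j \<in> J \<Longrightarrow> card {\<rho> \<in> R. \<pi> \<rho> = j} = k"
    and t: "\<And>i j. i \<in> J \<Longrightarrow> j \<in> J \<Longrightarrow> i \<noteq> j \<Longrightarrow> card {\<rho> \<in> R. a \<rho> i \<noteq> 0 \<and> a \<rho> j \<noteq> 0} \<le> t"
    and indep: "\<And>c i. (\<And>j. j \<in> J \<Longrightarrow> (\<Sum>l<N. c l * \<Phi> l j) = 0) \<Longrightarrow> i < N \<Longrightarrow> c i = 0"
    and rel: "\<And>\<rho> i. \<rho> \<in> R \<Longrightarrow> i < N \<Longrightarrow> (\<Sum>j\<in>J. a \<rho> j * \<Phi> i j) = 0"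
  shows "N * k \<le> t * card J"
proof -
  define n where "n = real (card J)"
  have card_R: "real (card R) = n * real k"
  proof -
    have "card R = (\<Sum>j\<in>J. card {\<rho> \<in> R. \<pi> \<rho> = j})"
      using sum_fun_comp[OF R J, of \<pi> "\<lambda>_. 1 :: nat"] \<pi>(1) by auto
    then show ?thesis by (simp add: k n_def)
  qed
  have diag_one: "(cmod (a \<rho> (\<pi> \<rho>)))\<^sup>2 = 1" if "\<rho> \<in> R" for \<rho>
    using \<pi>(2)[OF that] by simp
  \<comment> \<open>The diagonal of \<open>E\<close> contributes at most
    \<open>n * \<epsilon>\<^sup>2\<close>. Off the diagonal, Cauchy-Schwarz over at most
    \<open>t\<close> common rows leaves \<open>t\<close> times a sum of
    \<open>p \<rho> i * p \<rho> j\<close>; summed over all \<open>i\<close> and \<open>j\<close>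
    each row gives the square of its row sum 1, and there are \<open>n * k\<close> rows.\<close>
  have bound: "real N * (real k)\<^sup>2 \<le> n * \<epsilon>\<^sup>2 + real t * (n * real k)" if \<epsilon>: "\<epsilon> > 0" for \<epsilon> :: real
  proof -
    obtain y where y: "\<And>j. j \<in> J \<Longrightarrow>
       \<bar>(\<Sum>\<rho>\<in>R. (cmod (a \<rho> j))\<^sup>2 * exp (y j) / (\<Sum>i\<in>J. (cmod (a \<rho> i))\<^sup>2 * exp (y i))) - real k\<bar> \<le> \<epsilon>"
      by (rule row_column_scaling[where w = "\<lambda>\<rho> j. (cmod (a \<rho> j))\<^sup>2",
            OF J R zero_le_power2 \<pi>(1) diag_one k \<epsilon>]) (assumption | erule that)+
    define S where "S = (\<lambda>\<rho>. \<Sum>i\<in>J. (cmod (a \<rho> i))\<^sup>2 * exp (y i))"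
    \<comment> \<open>Square roots of the scaling factors, so that the squared moduli
      \<open>p\<close> have row sums 1 and column sums within \<open>\<epsilon>\<close> of
      \<open>k\<close>.\<close>
    define B where "B = (\<lambda>\<rho> j. a \<rho> j * complex_of_real (exp (y j / 2) / sqrt (S \<rho>)))"
    define p where "p = (\<lambda>\<rho> j. (cmod (a \<rho> j))\<^sup>2 * exp (y j) / S \<rho>)"
    have S_pos: "S \<rho> > 0" if "\<rho> \<in> R" for \<rho>
      unfolding S_def using J \<pi> that by (intro sum_pos2[of J "\<pi> \<rho>"]) auto
    have exp_half: "(exp (x / 2))\<^sup>2 = exp x" for x :: real
      by (simp flip: exp_double)
    have cmod_B: "(cmod (B \<rho> j))\<^sup>2 = p \<rho> j" if "\<rho> \<in> R" for \<rho> j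
      using S_pos[OF that]
      by (simp add: B_def p_def norm_mult norm_divide power_mult_distrib power_divide exp_half)
    have row_sum: "(\<Sum>j\<in>J. p \<rho> j) = 1" if "\<rho> \<in> R" for \<rho>
      using S_pos[OF that] by (simp add: p_def S_def flip: sum_divide_distrib)
    \<comment> \<open>The inverse of the column scaling keeps these vectors in the kernel of
      \<open>B\<close>; the scaling is by nonzero factors, so independence survives.\<close>
    define \<Theta> where "\<Theta> = (\<lambda>l j. \<Phi> l j * complex_of_real (exp (- (y j / 2))))"
    have \<Theta>_indep: "c i = 0" if "\<And>j. j \<in> J \<Longrightarrow> (\<Sum>l<N. c l * \<Theta> l j) = 0" "i < N" for c i
    proof (rule indep[OF _ that(2)])
      fix j assume "j \<in> J"
      from that(1)[OF this]
      have "(\<Sum>l<N. c l * \<Phi> l j) * complex_of_real (exp (- (y j / 2))) = 0"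
        by (simp add: \<Theta>_def sum_distrib_right mult.assoc)
      then show "(\<Sum>l<N. c l * \<Phi> l j) = 0" by simp
    qed
    have \<Theta>_rel: "(\<Sum>j\<in>J. B \<rho> j * \<Theta> i j) = 0" if "\<rho> \<in> R" "i < N" for \<rho> i
    proof -
      have "B \<rho> j * \<Theta> i j = a \<rho> j * \<Phi> i j / complex_of_real (sqrt (S \<rho>))" for j
        by (simp add: B_def \<Theta>_def exp_minus)
      then show ?thesis using rel[OF that] by (simp flip: sum_divide_distrib)
    qed
    have "\<exists>\<psi>. (\<forall>i<N. \<exists>c. \<forall>j\<in>J. \<psi> i j = (\<Sum>l<N. c l * \<Theta> l j)) \<and>
        (\<forall>i<N. \<forall>l<N. (\<Sum>j\<in>J. \<psi> i j * cnj (\<psi> l j)) = (if i = l then 1 else 0))"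
      by (rule orthonormal_system_exists[OF J], rule \<Theta>_indep) auto
    then obtain \<psi> where span: "\<forall>i<N. \<exists>c. \<forall>j\<in>J. \<psi> i j = (\<Sum>l<N. c l * \<Theta> l j)"
      and on: "\<forall>i<N. \<forall>l<N. (\<Sum>j\<in>J. \<psi> i j * cnj (\<psi> l j)) = (if i = l then 1 else 0)"
      by (elim exE conjE) (rule that)
    have \<psi>_rel: "(\<Sum>j\<in>J. B \<rho> j * \<psi> i j) = 0" if "\<rho> \<in> R" "i < N" for \<rho> i
    proof -
      obtain c where c: "\<And>j. j \<in> J \<Longrightarrow> \<psi> i j = (\<Sum>l<N. c l * \<Theta> l j)"
        using span \<open>i < N\<close> by blast
      have "(\<Sum>j\<in>J. B \<rho> j * \<psi> i j) = (\<Sum>j\<in>J. \<Sum>l<N. c l * (B \<rho> j * \<Theta> l j))"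
        by (simp add: c sum_distrib_left ac_simps)
      also have "\<dots> = (\<Sum>l<N. c l * (\<Sum>j\<in>J. B \<rho> j * \<Theta> l j))"
        by (subst sum.swap) (simp add: sum_distrib_left)
      finally show ?thesis using that by (simp add: \<Theta>_rel)
    qed
    define G where "G = (\<lambda>i j. \<Sum>\<rho>\<in>R. cnj (B \<rho> i) * B \<rho> j)"
    define E where "E = (\<lambda>i j. G i j - (if i = j then of_nat k else 0))"
    have eig: "(\<Sum>l\<in>J. E j l * \<psi> i l) = (- of_nat k) * \<psi> i j" if "i < N" "j \<in> J" for i j
    proof -
      have "(\<Sum>l\<in>J. G j l * \<psi> i l) = (\<Sum>l\<in>J. \<Sum>\<rho>\<in>R. cnj (B \<rho> j) * (B \<rho> l * \<psi> i l))"
        by (simp add: G_def sum_distrib_right mult.assoc)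
      also have "\<dots> = (\<Sum>\<rho>\<in>R. cnj (B \<rho> j) * (\<Sum>l\<in>J. B \<rho> l * \<psi> i l))"
        by (subst sum.swap) (simp add: sum_distrib_left)
      finally have "(\<Sum>l\<in>J. G j l * \<psi> i l) = 0" using that by (simp add: \<psi>_rel)
      moreover have "(\<Sum>l\<in>J. (if j = l then of_nat k else 0) * \<psi> i l) = of_nat k * \<psi> i j"
        using J that by (simp add: if_distrib[of "\<lambda>x. x * _"] cong: if_cong)
      ultimately show ?thesis by (simp add: E_def left_diff_distrib sum_subtractf)
    qed
    have diag: "(cmod (E j j))\<^sup>2 \<le> \<epsilon>\<^sup>2" if "j \<in> J" for j
    proof -
      have "G j j = (\<Sum>\<rho>\<in>R. complex_of_real (p \<rho> j))"
        unfolding G_def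
        by (rule sum.cong) (simp_all only: cmod_B[symmetric] complex_norm_square mult.commute)
      then have "E j j = complex_of_real ((\<Sum>\<rho>\<in>R. p \<rho> j) - real k)" by (simp add: E_def)
      then have "cmod (E j j) = \<bar>(\<Sum>\<rho>\<in>R. p \<rho> j) - real k\<bar>"
        by (simp only: norm_of_real)
      then have "cmod (E j j) \<le> \<epsilon>" using y[OF that] by (simp add: p_def S_def)
      then show ?thesis by (rule power_mono) simp
    qed
    have off_diag: "(cmod (E i j))\<^sup>2 \<le> real t * (\<Sum>\<rho>\<in>R. p \<rho> i * p \<rho> j)"
      if ij: "i \<in> J" "j \<in> J" "i \<noteq> j" for i j
    proof -
      define X where "X = {\<rho> \<in> R. a \<rho> i \<noteq> 0 \<and> a \<rho> j \<noteq> 0}"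
      have X: "finite X" "X \<subseteq> R" using R by (auto simp: X_def)
      have "E i j = (\<Sum>\<rho>\<in>X. cnj (B \<rho> i) * B \<rho> j)"
        using ij R by (simp add: E_def G_def) (rule sum.mono_neutral_right, auto simp: X_def B_def)
      then have "(cmod (E i j))\<^sup>2 \<le> real (card X) * (\<Sum>\<rho>\<in>X. (cmod (cnj (B \<rho> i) * B \<rho> j))\<^sup>2)"
        using norm_sum_power2_le[OF X(1)] by simp
      also have "\<dots> \<le> real t * (\<Sum>\<rho>\<in>R. (cmod (cnj (B \<rho> i) * B \<rho> j))\<^sup>2)"
        using t[OF ij] X R by (intro mult_mono sum_mono2) (auto simp: X_def sum_nonneg)
      also have "(\<Sum>\<rho>\<in>R. (cmod (cnj (B \<rho> i) * B \<rho> j))\<^sup>2) = (\<Sum>\<rho>\<in>R. p \<rho> i * p \<rho> j)"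
        by (rule sum.cong) (simp_all add: norm_mult power_mult_distrib cmod_B)
      finally show ?thesis .
    qed
    have p_nonneg: "0 \<le> p \<rho> j" if "\<rho> \<in> R" for \<rho> j
      using cmod_B[OF that, of j] by (metis zero_le_power2)
    have "real N * (cmod (- of_nat k))\<^sup>2 \<le> (\<Sum>i\<in>J. \<Sum>j\<in>J. (cmod (E i j))\<^sup>2)"
      by (rule eigenspace_dim_le_Frobenius[where \<psi> = \<psi>]) (use on eig in simp_all)
    also have "\<dots> \<le> (\<Sum>i\<in>J. \<Sum>j\<in>J. (if i = j then \<epsilon>\<^sup>2 else 0) + real t * (\<Sum>\<rho>\<in>R. p \<rho> i * p \<rho> j))"
    proof (intro sum_mono)
      fix i j assume ij: "i \<in> J" "j \<in> J"
      have "0 \<le> real t * (\<Sum>\<rho>\<in>R. p \<rho> i * p \<rho> j)"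
        by (intro mult_nonneg_nonneg sum_nonneg p_nonneg) auto
      then show "(cmod (E i j))\<^sup>2 \<le> (if i = j then \<epsilon>\<^sup>2 else 0) + real t * (\<Sum>\<rho>\<in>R. p \<rho> i * p \<rho> j)"
        using diag[of j] off_diag[of i j] ij by (cases "i = j") auto
    qed
    also have "\<dots> = n * \<epsilon>\<^sup>2 + real t * (\<Sum>i\<in>J. \<Sum>j\<in>J. \<Sum>\<rho>\<in>R. p \<rho> i * p \<rho> j)"
      using J by (simp add: sum.distrib n_def sum_distrib_left)
    also have "(\<Sum>i\<in>J. \<Sum>j\<in>J. \<Sum>\<rho>\<in>R. p \<rho> i * p \<rho> j) = (\<Sum>\<rho>\<in>R. (\<Sum>i\<in>J. p \<rho> i) * (\<Sum>j\<in>J. p \<rho> j))"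
    proof -
      have "(\<Sum>i\<in>J. \<Sum>j\<in>J. \<Sum>\<rho>\<in>R. p \<rho> i * p \<rho> j) = (\<Sum>i\<in>J. \<Sum>\<rho>\<in>R. \<Sum>j\<in>J. p \<rho> i * p \<rho> j)"
        by (intro sum.cong refl sum.swap)
      also have "\<dots> = (\<Sum>\<rho>\<in>R. \<Sum>i\<in>J. \<Sum>j\<in>J. p \<rho> i * p \<rho> j)" by (rule sum.swap)
      finally show ?thesis by (simp add: sum_product)
    qed
    also have "\<dots> = n * real k" by (simp add: row_sum card_R)
    finally show ?thesis by simp
  qed
  show ?thesis
  proof (rule ccontr)
    assume "\<not> N * k \<le> t * card J"
    then have less: "t * card J + 1 \<le> N * k" by simp
    then have "k > 0" by (cases k) auto
    have n: "n \<ge> 0" by (simp add: n_def)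
    \<comment> \<open>Failure of the claim means \<open>N * k \<ge> t * card J + 1\<close>.
      Multiplied by \<open>k\<close> and compared with \<open>bound\<close> this gives
      \<open>k \<le> n * \<epsilon>\<^sup>2\<close>, so any \<open>\<epsilon>\<close> making the
      right side less than 1 suffices.\<close>
    define \<epsilon> where "\<epsilon> = 1 / (n + 1)"
    have "\<epsilon> > 0" using n by (simp add: \<epsilon>_def)
    have "(real t * n + 1) * real k \<le> (real N * real k) * real k"
      using of_nat_mono[OF less, where 'a = real] by (intro mult_right_mono) (auto simp: n_def)
    then have "real k \<le> n * \<epsilon>\<^sup>2"
      using bound[OF \<open>\<epsilon> > 0\<close>] by (simp add: algebra_simps power2_eq_square)
    also have "\<dots> = n / (n + 1) / (n + 1)" by (simp add: \<epsilon>_def power2_eq_square)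
    also have "\<dots> < 1"
    proof -
      have "n / (n + 1) < 1" using n by simp
      then have "n / (n + 1) < n + 1" using n by linarith
      then show ?thesis using n by (subst pos_divide_less_eq) auto
    qed
    finally show False using \<open>k > 0\<close> by simp
  qed
qed

section \<open>Polynomial functions\<close>

text \<open>Only values matter later, so polynomials are kept as functions, generated by rules along
  which restriction to a line and differentiation go by induction. \<open>D\<close> is an upper
  bound for the degree; constants belong to every \<open>D\<close>.\<close>

inductive polyfun :: "nat \<Rightarrow> nat \<Rightarrow> (complex vec \<Rightarrow> complex) \<Rightarrow> bool" for d where
  const: "polyfun d D (\<lambda>_. c)"
| add: "polyfun d D f \<Longrightarrow> polyfun d D g \<Longrightarrow> polyfun d D (\<lambda>x. f x + g x)"
| coord: "i < d \<Longrightarrow> polyfun d D f \<Longrightarrow> polyfun d (Suc D) (\<lambda>x. x $ i * f x)"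

lemma polyfun_mono: "polyfun d D f \<Longrightarrow> D \<le> D' \<Longrightarrow> polyfun d D' f"
proof (induction arbitrary: D' rule: polyfun.induct)
  case (coord i D f)
  then obtain D'' where "D' = Suc D''" "D \<le> D''" by (cases D') auto
  then show ?case using coord by (auto intro: polyfun.coord)
qed (auto intro: polyfun.intros)

lemma polyfun_scale: "polyfun d D f \<Longrightarrow> polyfun d D (\<lambda>x. c * f x)"
proof (induction rule: polyfun.induct)
  case (add D f g)
  then show ?case using polyfun.add[OF add.IH] by (simp add: distrib_left)
next
  case (coord i D f)
  then show ?case using polyfun.coord[OF coord.hyps(1) coord.IH] by (simp add: ac_simps)
qed (rule polyfun.const)

lemma polyfun_sum:
  assumes "finite A" "\<And>l. l \<in> A \<Longrightarrow> polyfun d D (f l)"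
  shows "polyfun d D (\<lambda>x. \<Sum>l\<in>A. f l x)"
  using assms by (induction A rule: finite_induct) (auto intro: polyfun.intros)

lemma polyfun_monomial:
  assumes "m \<le> d" "\<And>i. i < m \<Longrightarrow> a i \<le> e"
  shows "polyfun d (m * e) (\<lambda>x. \<Prod>i<m. x $ i ^ a i)"
  using assms
proof (induction m)
  case 0
  then show ?case by (simp add: polyfun.const)
next
  case (Suc m)
  have "polyfun d (m * e + b) (\<lambda>x. x $ m ^ b * (\<Prod>i<m. x $ i ^ a i))" for b
  proof (induction b)
    case 0
    then show ?case using Suc by simp
  next
    case (Suc b)
    then show ?case
      using polyfun.coord[OF _ Suc.IH, of m] \<open>Suc m \<le> d\<close> by (simp add: mult.assoc)
  qed
  from polyfun_mono[OF this[of "a m"], of "Suc m * e"] Suc.prems(2)[of m]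
  show ?case by (simp add: mult.commute)
qed

lemma polyfun_line:
  assumes "polyfun d D f" "p \<in> carrier_vec d" "w \<in> carrier_vec d"
  shows "\<exists>q. degree q \<le> D \<and> (\<forall>t. f (p + t \<cdot>\<^sub>v w) = poly q t)"
  using assms(1)
proof (induction rule: polyfun.induct)
  case (const D c)
  then show ?case by (intro exI[of _ "[:c:]"]) auto
next
  case (add D f g)
  then obtain q q' where "degree q \<le> D" "\<forall>t. f (p + t \<cdot>\<^sub>v w) = poly q t"
    "degree q' \<le> D" "\<forall>t. g (p + t \<cdot>\<^sub>v w) = poly q' t" by blast
  then show ?case by (intro exI[of _ "q + q'"]) (auto intro: degree_add_le)
next
  case (coord i D f)
  then obtain q where q: "degree q \<le> D" "\<forall>t. f (p + t \<cdot>\<^sub>v w) = poly q t" by blast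
  have "degree ([:p $ i, w $ i:] * q) \<le> Suc D"
    using degree_mult_le[of "[:p $ i, w $ i:]" q] q(1) by (auto split: if_splits)
  then show ?case
    using q(2) assms(2,3) coord.hyps(1)
    by (intro exI[of _ "[:p $ i, w $ i:] * q"]) (auto simp: algebra_simps)
qed

text \<open>Differentiability is recorded only along complex lines, where one-variable calculus
  applies; at \<open>t = 0\<close> it is the derivative at \<open>p\<close> in direction
  \<open>w\<close>.\<close>

definition has_gradient ::
    "nat \<Rightarrow> (complex vec \<Rightarrow> complex) \<Rightarrow> (nat \<Rightarrow> complex vec \<Rightarrow> complex) \<Rightarrow> bool" where
  "has_gradient d f G \<longleftrightarrow> (\<forall>p\<in>carrier_vec d. \<forall>w\<in>carrier_vec d. \<forall>t.
     ((\<lambda>t. f (p + t \<cdot>\<^sub>v w)) has_field_derivative (\<Sum>i<d. w $ i * G i (p + t \<cdot>\<^sub>v w))) (at t))"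

lemma has_gradientD:
  "has_gradient d f G \<Longrightarrow> p \<in> carrier_vec d \<Longrightarrow> w \<in> carrier_vec d \<Longrightarrow>
    ((\<lambda>t. f (p + t \<cdot>\<^sub>v w)) has_field_derivative (\<Sum>i<d. w $ i * G i (p + t \<cdot>\<^sub>v w))) (at t)"
  by (auto simp: has_gradient_def)

text \<open>For \<open>D = 0\<close> the truncated \<open>D - 1\<close> says nothing, hence the extra clause.\<close>
lemma polyfun_gradient:
  assumes "polyfun d D f"
  shows "\<exists>G. (\<forall>i. polyfun d (D - 1) (G i)) \<and> (D = 0 \<longrightarrow> (\<forall>i x. G i x = 0)) \<and>
    has_gradient d f G"
  using assms
proof (induction rule: polyfun.induct)
  case (const D c)
  then show ?case by (intro exI[of _ "\<lambda>_ _. 0"]) (auto simp: has_gradient_def intro: polyfun.const)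
next
  case (add D f g)
  from add.IH obtain G H where
    GH: "\<forall>i. polyfun d (D - 1) (G i)" "D = 0 \<longrightarrow> (\<forall>i x. G i x = 0)"
      "\<forall>i. polyfun d (D - 1) (H i)" "D = 0 \<longrightarrow> (\<forall>i x. H i x = 0)"
    and dG: "has_gradient d f G" and dH: "has_gradient d g H"
    by blast
  show ?case
    unfolding has_gradient_def
  proof (intro exI[of _ "\<lambda>i x. G i x + H i x"] conjI allI ballI impI)
    fix p w :: "complex vec" and t assume "p \<in> carrier_vec d" "w \<in> carrier_vec d"
    from DERIV_add[OF has_gradientD[OF dG this] has_gradientD[OF dH this]]
    show "((\<lambda>t. f (p + t \<cdot>\<^sub>v w) + g (p + t \<cdot>\<^sub>v w)) has_field_derivative
       (\<Sum>i<d. w $ i * (G i (p + t \<cdot>\<^sub>v w) + H i (p + t \<cdot>\<^sub>v w)))) (at t)"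
      by (simp add: distrib_left sum.distrib)
  qed (use GH in \<open>auto intro: polyfun.add\<close>)
next
  case (coord j D f)
  from coord.IH obtain G where
    G: "\<forall>i. polyfun d (D - 1) (G i)" "D = 0 \<longrightarrow> (\<forall>i x. G i x = 0)"
    and dG: "has_gradient d f G"
    by blast
  show ?case
    unfolding has_gradient_def
  \<comment> \<open>The product rule for the coordinate function times \<open>f\<close>.\<close>
  proof (intro exI[of _ "\<lambda>i x. (if i = j then f x else 0) + x $ j * G i x"] conjI allI ballI impI)
    fix i
    have "polyfun d D (\<lambda>x. if i = j then f x else 0)"
      using coord.hyps(2) by (cases "i = j") (auto intro: polyfun.const)
    moreover have "polyfun d D (\<lambda>x. x $ j * G i x)"
    proof (cases D)
      case 0
      then show ?thesis using G(2) by (simp add: polyfun.const)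
    next
      case (Suc D')
      then show ?thesis using G(1) coord.hyps(1) polyfun.coord[of j d D' "G i"] by simp
    qed
    ultimately show "polyfun d (Suc D - 1) (\<lambda>x. (if i = j then f x else 0) + x $ j * G i x)"
      by (simp add: polyfun.add)
  next
    fix p w :: "complex vec" and t assume p: "p \<in> carrier_vec d" and w: "w \<in> carrier_vec d"
    have idx: "(p + t \<cdot>\<^sub>v w) $ j = p $ j + t * w $ j" for t
      using p w coord.hyps(1) by simp
    have "((\<lambda>t. p $ j + t * w $ j) has_field_derivative w $ j) (at t)"
      by (auto intro!: derivative_eq_intros)
    from DERIV_mult[OF this has_gradientD[OF dG p w]]
    have "((\<lambda>t. (p + t \<cdot>\<^sub>v w) $ j * f (p + t \<cdot>\<^sub>v w)) has_field_derivative
       w $ j * f (p + t \<cdot>\<^sub>v w) +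
       (\<Sum>i<d. w $ i * G i (p + t \<cdot>\<^sub>v w)) * (p + t \<cdot>\<^sub>v w) $ j) (at t)"
      unfolding idx .
    also have "w $ j * f (p + t \<cdot>\<^sub>v w) + (\<Sum>i<d. w $ i * G i (p + t \<cdot>\<^sub>v w)) * (p + t \<cdot>\<^sub>v w) $ j =
       (\<Sum>i<d. w $ i * ((if i = j then f (p + t \<cdot>\<^sub>v w) else 0) + (p + t \<cdot>\<^sub>v w) $ j * G i (p + t \<cdot>\<^sub>v w)))"
      using coord.hyps(1)
      by (simp add: distrib_left sum.distrib sum_distrib_right sum_distrib_left if_distrib[of "\<lambda>x. _ * x"] ac_simps cong: if_cong)
    finally show "((\<lambda>t. (p + t \<cdot>\<^sub>v w) $ j * f (p + t \<cdot>\<^sub>v w)) has_field_derivative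
       (\<Sum>i<d. w $ i * ((if i = j then f (p + t \<cdot>\<^sub>v w) else 0) + (p + t \<cdot>\<^sub>v w) $ j * G i (p + t \<cdot>\<^sub>v w)))) (at t)" .
  qed auto
qed

section \<open>Lines and hyperplanes\<close>

text \<open>An independent subset of \<open>W\<close> of maximal size spans \<open>W\<close>, since
  any vector outside its span could be added. Span and independence are then transferred to the
  restricted structure, in which the dimension of a flat is taken.\<close>

lemma (in vec_space) subspace_has_basis:
  assumes W: "VectorSpace.subspace class_ring W V"
  obtains B where "finite B" "B \<subseteq> W" "lin_indpt B" "span B = W"
    "vectorspace.dim class_ring (V\<lparr>carrier := W\<rparr>) = card B"
proof -
  have sub: "submodule class_ring W V" using W by (simp add: VectorSpace.subspace_def)
  have WV: "W \<subseteq> carrier_vec n" using sub by (auto simp: submodule_def)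
  let ?P = "\<lambda>m. \<exists>B. finite B \<and> B \<subseteq> W \<and> lin_indpt B \<and> card B = m"
  have P0: "?P 0" by (intro exI[of _ "{}"]) (auto simp: lin_dep_def)
  have bnd: "\<forall>m. ?P m \<longrightarrow> m \<le> n"
    using li_le_dim(2) WV by (auto simp: dim_is_n)
  define m where "m = Greatest ?P"
  have "?P m" unfolding m_def using GreatestI_nat[of ?P 0 n] P0 bnd by blast
  then obtain B where B: "finite B" "B \<subseteq> W" "lin_indpt B" "card B = m" by blast
  have "v \<in> span B" if v: "v \<in> W" for v
  proof (rule ccontr)
    assume nin: "v \<notin> span B"
    then have "v \<notin> B" using in_own_span[of B] B(2) WV by auto
    then have "lin_indpt (B \<union> {v})"
      using nin lin_dep_iff_in_span[of B v] B v WV by auto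
    then have "?P (Suc m)"
      using B v \<open>v \<notin> B\<close> by (intro exI[of _ "insert v B"]) auto
    then have "Suc m \<le> m" unfolding m_def by (rule Greatest_le_nat[where b = n]) (use bnd in auto)
    then show False by simp
  qed
  moreover have "span B \<subseteq> W" by (rule span_is_subset[OF B(2) sub])
  ultimately have span: "span B = W" by auto
  interpret W: vectorspace class_ring "V\<lparr>carrier := W\<rparr>" by (rule subspace_is_vs[OF W])
  have "W.gen_set B"
    using span_li_not_depend(1)[OF B(2) sub] span by simp
  moreover have "W.lin_indpt B"
    using span_li_not_depend(2)[OF B(2) sub] B(3) by simp
  ultimately have "W.basis B" using B(2) by (auto simp: W.basis_def)
  then have "W.dim = card B" by (rule W.dim_basis[OF B(1)])
  then show thesis using B span that by blast
qed

lemma is_flat_1_line: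
  assumes "is_flat d 1 L"
  obtains p w where "p \<in> carrier_vec d" "w \<in> carrier_vec d" "w \<noteq> 0\<^sub>v d"
    "L = {p + t \<cdot>\<^sub>v w |t. True}"
proof -
  interpret vec_space "TYPE(complex)" d .
  from assms obtain p W where p: "p \<in> carrier_vec d"
    and W: "VectorSpace.subspace class_ring W (module_vec TYPE(complex) d)"
    and dim: "vectorspace.dim class_ring (module_vec TYPE(complex) d\<lparr>carrier := W\<rparr>) = 1"
    and L: "L = (\<lambda>w. p + w) ` W"
    unfolding is_flat_def by blast
  from W obtain B where B: "finite B" "B \<subseteq> W" "lin_indpt B" "span B = W" "card B = 1"
    by (rule subspace_has_basis) (use dim in simp)
  then obtain w where w: "B = {w}" by (auto simp: card_1_singleton_iff)
  have wc: "w \<in> carrier_vec d" using B(2) w W by (auto simp: VectorSpace.subspace_def submodule_def)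
  \<comment> \<open>Excludes the trivial ring, over which the zero vector alone would be
    independent.\<close>
  have "(UNIV :: complex set) \<noteq> {0}" by (metis UNIV_I singletonD zero_neq_one)
  then have "w \<noteq> 0\<^sub>v d" using B(3) w zero_lin_dep by auto
  moreover have "W = {t \<cdot>\<^sub>v w |t. True}"
    using wc finite_span[of "{w}"] by (auto simp: B(4)[symmetric] w lincomb_def)
  ultimately show thesis using that[OF p wc] L by auto
qed

text \<open>The set is the translate by \<open>p\<close> of the kernel of a nonzero linear
  functional, and rank-nullity gives the dimension. The functional takes values in
  \<open>carrier_vec 1\<close> so that it is a map between vector spaces of the same kind.\<close>

lemma hyperplane_is_flat:
  assumes p: "p \<in> carrier_vec d" and g: "\<exists>i<d. g i \<noteq> 0"
  shows "is_flat d (d - 1) {x \<in> carrier_vec d. (\<Sum>i<d. (x $ i - p $ i) * g i) = (0 :: complex)}"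
proof -
  interpret V: vec_space "TYPE(complex)" d .
  interpret U: vec_space "TYPE(complex)" 1 .
  define T where "T = (\<lambda>v. vec 1 (\<lambda>_. \<Sum>i<d. v $ i * g i) :: complex vec)"
  interpret T: linear_map class_ring "module_vec TYPE(complex) d" "module_vec TYPE(complex) 1" T
  proof (unfold_locales)
    show "T \<in> LinearCombinations.module_hom class_ring (module_vec TYPE(complex) d) (module_vec TYPE(complex) 1)"
      by (auto simp: LinearCombinations.module_hom_def T_def module_vec_simps distrib_right
          sum.distrib sum_distrib_left mult.assoc intro!: eq_vecI)
  qed
  obtain j where j: "j < d" "g j \<noteq> 0" using g by blast
  have "T.imT = carrier_vec 1"
  proof
    show "carrier_vec 1 \<subseteq> T.imT"
    proof
      fix u :: "complex vec" assume u: "u \<in> carrier_vec 1"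
      have "T ((u $ 0 / g j) \<cdot>\<^sub>v unit_vec d j) = u"
        using j u by (intro eq_vecI) (auto simp: T_def if_distrib[of "\<lambda>x. _ * x"] if_distrib[of "\<lambda>x. x * _"] cong: if_cong)
      moreover have "(u $ 0 / g j) \<cdot>\<^sub>v unit_vec d j \<in> carrier_vec d" by simp
      ultimately show "u \<in> T.imT" unfolding T.im_def by (metis V.cV imageI)
    qed
  next
    show "T.imT \<subseteq> carrier_vec 1" unfolding T.im_def by (auto simp: T_def)
  qed
  then have im: "vectorspace.dim class_ring (U.vs T.imT) = 1"
    using U.dim_is_n by (simp add: module_vec_def)
  have ker: "vectorspace.dim class_ring (V.vs T.kerT) = d - 1"
    using T.rank_nullity[OF V.fin_dim] V.dim_is_n im by simp
  have "is_flat d (d - 1) ((\<lambda>w. p + w) ` T.kerT)"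
    unfolding is_flat_def using p ker T.kerT_is_subspace by blast
  also have "(\<lambda>w. p + w) ` T.kerT =
     {x \<in> carrier_vec d. (\<Sum>i<d. (x $ i - p $ i) * g i) = (0 :: complex)}"
  proof -
    have ker_eq: "T.kerT = {v \<in> carrier_vec d. (\<Sum>i<d. v $ i * g i) = 0}"
      unfolding T.ker_def by (auto simp: T_def module_vec_simps vec_eq_iff)
    show ?thesis
      unfolding ker_eq
    proof (intro equalityI subsetI)
      fix x assume "x \<in> (\<lambda>w. p + w) ` {v \<in> carrier_vec d. (\<Sum>i<d. v $ i * g i) = 0}"
      then show "x \<in> {x \<in> carrier_vec d. (\<Sum>i<d. (x $ i - p $ i) * g i) = 0}"
        using p by auto
    next
      fix x assume x: "x \<in> {x \<in> carrier_vec d. (\<Sum>i<d. (x $ i - p $ i) * g i) = 0}"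
      then have "x - p \<in> {v \<in> carrier_vec d. (\<Sum>i<d. v $ i * g i) = 0}" using p by auto
      moreover have "x = p + (x - p)" using x p by (intro eq_vecI) auto
      ultimately show "x \<in> (\<lambda>w. p + w) ` {v \<in> carrier_vec d. (\<Sum>i<d. v $ i * g i) = 0}" by blast
    qed
  qed
  finally show ?thesis .
qed

section \<open>Interpolation on lines, and tangent hyperplanes of vanishing polynomials\<close>

lemma lagrange_relation:
  fixes S :: "'a :: field set"
  assumes S: "finite S" "card S = Suc D"
  shows "\<exists>b. \<forall>q. degree q \<le> D \<longrightarrow> poly q \<tau> = (\<Sum>s\<in>S. b s * poly q s)"
proof -
  \<comment> \<open>The Lagrange basis polynomials of the nodes; the coefficients \<open>b s\<close>
    are their values at \<open>\<tau>\<close>, hence the same for every \<open>q\<close>.\<close>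
  define l where "l = (\<lambda>s. Polynomial.smult (inverse (\<Prod>u\<in>S - {s}. s - u)) (\<Prod>u\<in>S - {s}. [:- u, 1:]))"
  have poly_l: "poly (l s) x = (\<Prod>u\<in>S - {s}. x - u) / (\<Prod>u\<in>S - {s}. s - u)" for s x
    by (simp add: l_def poly_prod divide_inverse mult.commute)
  have l_same: "poly (l s) s = 1" if "s \<in> S" for s
    using S by (simp add: poly_l)
  have l_other: "poly (l s) u = 0" if "u \<in> S" "u \<noteq> s" for s u
    using S that by (simp add: poly_l)
  have deg_l: "degree (l s) \<le> D" if "s \<in> S" for s
  proof -
    have "degree (\<Prod>u\<in>S - {s}. [:- u, 1:]) \<le> sum (degree \<circ> (\<lambda>u. [:- u, 1:])) (S - {s})"
      by (rule degree_prod_sum_le) (use S in auto)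
    also have "\<dots> = D" using S that by (simp add: card_Diff_singleton)
    finally show ?thesis by (simp add: l_def)
  qed
  show ?thesis
  proof (intro exI[of _ "\<lambda>s. poly (l s) \<tau>"] allI impI)
    fix q :: "'a poly" assume q: "degree q \<le> D"
    define q' where "q' = (\<Sum>s\<in>S. Polynomial.smult (poly q s) (l s))"
    have "q = q'"
    proof (rule poly_eqI_degree[of S])
      fix x assume x: "x \<in> S"
      have "poly q' x = (\<Sum>s\<in>S. if s = x then poly q x else 0)"
        unfolding q'_def poly_sum using l_same l_other x by (intro sum.cong) auto
      then show "poly q x = poly q' x" using S x by simp
    next
      show "card S > degree q" using q S by simp
      have "degree q' \<le> D"
        unfolding q'_def using deg_l S degree_smult_le
        by (intro degree_sum_le) (auto intro: order.trans)
      then show "card S > degree q'" using S by simp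
    qed
    then have "poly q \<tau> = poly q' \<tau>" by simp
    then show "poly q \<tau> = (\<Sum>s\<in>S. poly (l s) \<tau> * poly q s)"
      by (simp add: q'_def poly_sum mult.commute)
  qed
qed

lemma line_subset_carrier: "is_flat d 1 L \<Longrightarrow> L \<subseteq> carrier_vec d"
  by (erule is_flat_1_line) auto

lemma line_through:
  assumes L: "is_flat d 1 L" and x: "x \<in> L" and y: "y \<in> L" and xy: "x \<noteq> y"
  shows "L = {x + t \<cdot>\<^sub>v (y - x) |t. True}"
proof -
  from L obtain p w where pw: "p \<in> carrier_vec d" "w \<in> carrier_vec d" "w \<noteq> 0\<^sub>v d"
    and L: "L = {p + t \<cdot>\<^sub>v w |t. True}" by (rule is_flat_1_line)
  obtain a b where a: "x = p + a \<cdot>\<^sub>v w" and b: "y = p + b \<cdot>\<^sub>v w" using x y L by auto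
  have "a \<noteq> b" using a b xy by auto
  have "x + t \<cdot>\<^sub>v (y - x) = p + (a + t * (b - a)) \<cdot>\<^sub>v w" for t
    using pw by (intro eq_vecI) (auto simp: a b algebra_simps)
  moreover have "p + c \<cdot>\<^sub>v w = x + ((c - a) / (b - a)) \<cdot>\<^sub>v (y - x)" for c
  proof -
    have "c = a + (c - a) / (b - a) * (b - a)" using \<open>a \<noteq> b\<close> by simp
    then show ?thesis using calculation by metis
  qed
  ultimately show ?thesis unfolding L by blast
qed

lemma line_unique:
  assumes "is_flat d 1 L" "is_flat d 1 L'" "x \<noteq> y" "x \<in> L" "y \<in> L" "x \<in> L'" "y \<in> L'"
  shows "L = L'"
  using line_through[OF assms(1,4,5,3)] line_through[OF assms(2,6,7,3)] by simp

text \<open>Lagrange interpolation in a parameter of the line. As \<open>b\<close> is chosen before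
  \<open>f\<close>, one such relation gives a matrix row that annihilates all polynomials of degree
  at most \<open>D\<close> at once.\<close>

lemma line_relation:
  assumes L: "is_flat d 1 L" and S: "S \<subseteq> L" "finite S" "card S = Suc D" and x: "x \<in> L"
  shows "\<exists>b. \<forall>f. polyfun d D f \<longrightarrow> f x = (\<Sum>s\<in>S. b s * f s)"
proof -
  from L obtain p w where pw: "p \<in> carrier_vec d" "w \<in> carrier_vec d" "w \<noteq> 0\<^sub>v d"
    and L: "L = {p + t \<cdot>\<^sub>v w |t. True}" by (rule is_flat_1_line)
  have "\<forall>s\<in>L. \<exists>t. s = p + t \<cdot>\<^sub>v w" using L by auto
  then obtain \<tau> where \<tau>: "\<And>s. s \<in> L \<Longrightarrow> s = p + \<tau> s \<cdot>\<^sub>v w" by metis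
  have inj: "inj_on \<tau> S" using \<tau> S(1) by (metis inj_onI subsetD)
  have "finite (\<tau> ` S)" "card (\<tau> ` S) = Suc D" using S card_image[OF inj] by auto
  from lagrange_relation[OF this, of "\<tau> x"] obtain b where
    b: "\<And>q. degree q \<le> D \<Longrightarrow> poly q (\<tau> x) = (\<Sum>s\<in>\<tau> ` S. b s * poly q s)" by blast
  show ?thesis
  proof (intro exI[of _ "b \<circ> \<tau>"] allI impI)
    fix f assume "polyfun d D f"
    from polyfun_line[OF this pw(1,2)] obtain q where
      q: "degree q \<le> D" "\<And>t. f (p + t \<cdot>\<^sub>v w) = poly q t" by blast
    have fq: "f s = poly q (\<tau> s)" if "s \<in> L" for s
      using q(2)[of "\<tau> s"] \<tau>[OF that] by simp
    show "f x = (\<Sum>s\<in>S. (b \<circ> \<tau>) s * f s)"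
      using b[OF q(1)] fq x S(1) by (simp add: sum.reindex[OF inj] subset_iff cong: sum.cong)
  qed
qed

lemma polyfun_vanishes_on_line:
  assumes L: "is_flat d 1 L" and f: "polyfun d D f"
    and S: "S \<subseteq> L" "D < card S" "\<And>s. s \<in> S \<Longrightarrow> f s = 0" and x: "x \<in> L"
  shows "f x = 0"
proof -
  obtain S' where S': "S' \<subseteq> S" "card S' = Suc D" "finite S'"
    using obtain_subset_with_card_n[of "Suc D" S] S(2) by auto
  then obtain b where "\<And>f. polyfun d D f \<Longrightarrow> f x = (\<Sum>s\<in>S'. b s * f s)"
    using line_relation[OF L _ S'(3,2) x] S(1) by blast
  then have "f x = (\<Sum>s\<in>S'. b s * f s)" using f by blast
  also have "\<dots> = 0" using S(3) S'(1) by (intro sum.neutral) auto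
  finally show ?thesis .
qed

text \<open>Along the line \<open>f\<close> is constantly zero, so its derivative at
  \<open>p\<close> in direction \<open>x - p\<close> is zero. For fixed \<open>p\<close> the
  resulting equation does not depend on the line: it is that of the tangent hyperplane.\<close>

lemma gradient_orthogonal_to_line:
  assumes L: "is_flat d 1 L" and f: "\<And>x. x \<in> L \<Longrightarrow> f x = 0" and G: "has_gradient d f G"
    and p: "p \<in> L" and x: "x \<in> L"
  shows "(\<Sum>i<d. (x $ i - p $ i) * G i p) = 0"
proof (cases "x = p")
  case False
  have pc: "p \<in> carrier_vec d" and xc: "x \<in> carrier_vec d"
    using line_subset_carrier[OF L] p x by auto
  then have w: "x - p \<in> carrier_vec d" by simp
  have p0: "p + 0 \<cdot>\<^sub>v (x - p) = p" using pc xc by (intro eq_vecI) auto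
  have "p + t \<cdot>\<^sub>v (x - p) \<in> L" for t
    using line_through[OF L p x] False by auto
  then have "(\<lambda>t. f (p + t \<cdot>\<^sub>v (x - p))) = (\<lambda>_. 0)" using f by auto
  then have "((\<lambda>_. 0) has_field_derivative (\<Sum>i<d. (x - p) $ i * G i p)) (at 0)"
    using has_gradientD[OF G pc w, of 0] by (simp add: p0)
  then have "(\<Sum>i<d. (x - p) $ i * G i p) = 0"
    using DERIV_const DERIV_unique by blast
  then show ?thesis using pc xc by simp
qed simp

lemma polyfun_gradient_zero_imp_const:
  assumes f: "polyfun d D f" and G: "has_gradient d f G"
    and zero: "\<And>i x. i < d \<Longrightarrow> x \<in> carrier_vec d \<Longrightarrow> G i x = 0"
    and x: "x \<in> carrier_vec d" and y: "y \<in> carrier_vec d"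
  shows "f x = f y"
proof -
  have w: "y - x \<in> carrier_vec d" using x y by simp
  obtain q where q: "\<And>t. f (x + t \<cdot>\<^sub>v (y - x)) = poly q t"
    using polyfun_line[OF f x w] by blast
  have "poly (pderiv q) t = 0" for t
  proof (rule DERIV_unique[OF poly_DERIV])
    have "((\<lambda>t. f (x + t \<cdot>\<^sub>v (y - x))) has_field_derivative
        (\<Sum>i<d. (y - x) $ i * G i (x + t \<cdot>\<^sub>v (y - x)))) (at t)"
      by (rule has_gradientD[OF G x w])
    moreover have "(\<Sum>i<d. (y - x) $ i * G i (x + t \<cdot>\<^sub>v (y - x))) = 0"
      using zero x y by (intro sum.neutral) auto
    ultimately show "(poly q has_field_derivative 0) (at t)"
      by (simp add: q)
  qed
  then have "pderiv q = 0" by (simp add: poly_all_0_iff_0 [symmetric])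
  then have "degree q = 0" by (simp add: pderiv_eq_0_iff)
  then have "poly q 0 = poly q 1" by (metis degree_eq_zeroE poly_pCons mult_zero_right poly_0)
  moreover have "x + 0 \<cdot>\<^sub>v (y - x) = x" "x + 1 \<cdot>\<^sub>v (y - x) = y"
    using x y by (auto intro!: eq_vecI)
  ultimately show ?thesis using q[of 0] q[of 1] by simp
qed

text \<open>Take a vanishing \<open>g\<close>, not identically zero, with the least possible bound
  \<open>D'\<close>. If its partial derivatives all vanished on \<open>A\<close>, then, having a
  smaller bound, they would vanish everywhere; \<open>g\<close> would be constant, and equal to zero
  because \<open>A\<close> is nonempty.\<close>

lemma vanishing_polyfun_regular_point:
  assumes A: "A \<subseteq> carrier_vec d" "A \<noteq> {}"
    and f: "polyfun d D f" "\<And>a. a \<in> A \<Longrightarrow> f a = 0" and x: "x \<in> carrier_vec d" "f x \<noteq> 0"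
  obtains D' g G p where "D' \<le> D" "polyfun d D' g" "\<And>a. a \<in> A \<Longrightarrow> g a = 0"
    "has_gradient d g G" "p \<in> A" "\<exists>i<d. G i p \<noteq> 0"
proof -
  define Q where "Q = (\<lambda>D. \<exists>f. polyfun d D f \<and> (\<forall>a\<in>A. f a = 0) \<and> (\<exists>x\<in>carrier_vec d. f x \<noteq> 0))"
  define D' where "D' = (LEAST D. Q D)"
  have "Q D" using f x by (auto simp: Q_def)
  then have "Q D'" "D' \<le> D" unfolding D'_def by (rule LeastI, rule Least_le)
  then obtain g where g: "polyfun d D' g" "\<And>a. a \<in> A \<Longrightarrow> g a = 0" "\<exists>x\<in>carrier_vec d. g x \<noteq> 0"
    unfolding Q_def by blast
  obtain G where G: "\<And>i. polyfun d (D' - 1) (G i)" "D' = 0 \<Longrightarrow> G i x = 0" "has_gradient d g G" for i x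
    using polyfun_gradient[OF g(1)] by blast
  have "\<exists>p\<in>A. \<exists>i<d. G i p \<noteq> 0"
  proof (rule ccontr)
    assume "\<not> (\<exists>p\<in>A. \<exists>i<d. G i p \<noteq> 0)"
    then have vanish: "G i a = 0" if "i < d" "a \<in> A" for i a using that by blast
    have zero: "G i x = 0" if "i < d" "x \<in> carrier_vec d" for i x
    proof (cases "D' = 0")
      case False
      then have "\<not> Q (D' - 1)" unfolding D'_def by (intro not_less_Least) auto
      then show ?thesis using G(1)[of i] vanish that unfolding Q_def by blast
    qed (rule G(2))
    obtain a where "a \<in> A" using A(2) by blast
    have "g x = 0" if "x \<in> carrier_vec d" for x
      using polyfun_gradient_zero_imp_const[OF g(1) G(3) zero that, of a] g(2) \<open>a \<in> A\<close> A(1) by auto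
    then show False using g(3) by blast
  qed
  then show thesis using that[OF \<open>D' \<le> D\<close> g(1,2) G(3)] by blast
qed

section \<open>Linear independence of the monomials of bounded exponents\<close>

lemma digit_sum:
  "(\<Sum>i<d. (n div B ^ i mod B) * B ^ i) = n mod B ^ d" for n B d :: nat
proof (induction d)
  case (Suc d)
  then show ?case using mod_mult2_eq[of n "B ^ d" B] by (simp add: mult.commute)
qed simp

text \<open>Exponent vectors are encoded by the base \<open>B\<close> digits of \<open>n\<close>; Kronecker's substitution
  \<open>x\<^sub>i = t ^ B ^ i\<close> turns the monomial with code \<open>n\<close> into \<open>t ^ n\<close>.\<close>
lemma monomials_independent:
  fixes c :: "nat \<Rightarrow> complex"
  assumes zero: "\<And>x. x \<in> carrier_vec d \<Longrightarrow>
       (\<Sum>n<B ^ d. c n * (\<Prod>i<d. x $ i ^ (n div B ^ i mod B))) = 0"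
    and n: "n < B ^ d"
  shows "c n = 0"
proof -
  define q where "q = (\<Sum>n<B ^ d. monom (c n) n)"
  have "poly q t = 0" for t
  proof -
    define x where "x = vec d (\<lambda>i. t ^ B ^ i)"
    have xc: "x \<in> carrier_vec d" by (simp add: x_def)
    have "(\<Prod>i<d. x $ i ^ (n div B ^ i mod B)) = t ^ n" if "n < B ^ d" for n
    proof -
      have "(\<Prod>i<d. x $ i ^ (n div B ^ i mod B)) = (\<Prod>i<d. t ^ ((n div B ^ i mod B) * B ^ i))"
        by (rule prod.cong) (auto simp: x_def mult.commute simp flip: power_mult)
      also have "\<dots> = t ^ (n mod B ^ d)" by (simp add: digit_sum flip: power_sum)
      finally show ?thesis using that by simp
    qed
    then have "(\<Sum>n<B ^ d. c n * t ^ n) =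
        (\<Sum>n<B ^ d. c n * (\<Prod>i<d. x $ i ^ (n div B ^ i mod B)))"
      by (intro sum.cong) auto
    also have "\<dots> = 0" by (rule zero[OF xc])
    finally have "(\<Sum>n<B ^ d. c n * t ^ n) = 0" .
    then show ?thesis by (simp add: q_def poly_sum poly_monom)
  qed
  then have "q = 0" by (simp add: poly_all_0_iff_0 [symmetric])
  moreover have "coeff q n = c n"
    using n by (simp add: q_def coeff_sum)
  ultimately show ?thesis by simp
qed

section \<open>Rich lines through a regular point\<close>

text \<open>The rows of the design matrix are pairs of a point \<open>p\<close> and a line through
  it. Such a row has 1 at \<open>p\<close> and minus the interpolation coefficients at
  \<open>D + 1\<close> other points of the line, whence \<open>d * e + 2\<close> points are
  required. The assumption \<open>large\<close> contradicts the rank bound with \<open>t = r\<close>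
  and \<open>N = (e + 1) ^ d\<close>. The marked points \<open>T L\<close> keep \<open>t\<close>
  small even when a line has far more than \<open>r\<close> points.\<close>

lemma lines_through_regular_point_coplanar:
  fixes T :: "complex vec set \<Rightarrow> complex vec set"
  assumes A: "finite A" "A \<subseteq> carrier_vec d" "A \<noteq> {}" and Ls: "finite Ls"
    and L: "\<And>L. L \<in> Ls \<Longrightarrow> is_flat d 1 L"
      "\<And>L. L \<in> Ls \<Longrightarrow> T L \<subseteq> L" "\<And>L. L \<in> Ls \<Longrightarrow> finite (T L)" "\<And>L. L \<in> Ls \<Longrightarrow> card (T L) \<le> r"
      "\<And>L. L \<in> Ls \<Longrightarrow> d * e + 2 \<le> card (T L \<inter> A)"
    and k: "\<And>p. p \<in> A \<Longrightarrow> k \<le> card {L \<in> Ls. p \<in> T L}"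
    and large: "r * card A < (e + 1) ^ d * k"
  obtains p F where "p \<in> A" "is_flat d (d - 1) F" "\<And>L. L \<in> Ls \<Longrightarrow> p \<in> T L \<Longrightarrow> L \<subseteq> F"
proof -
  define D where "D = d * e"
  \<comment> \<open>Exactly \<open>k\<close> lines are kept at every point, because the scaling
    requires equally many rows for each column.\<close>
  have "\<forall>p\<in>A. \<exists>X. X \<subseteq> {L \<in> Ls. p \<in> T L} \<and> card X = k"
    by (intro ballI, rule obtain_subset_with_card_n[OF k]) blast+
  then obtain X where "\<forall>p\<in>A. X p \<subseteq> {L \<in> Ls. p \<in> T L} \<and> card (X p) = k"
    by (elim bchoice[THEN exE])
  then have X: "\<And>p. p \<in> A \<Longrightarrow> X p \<subseteq> {L \<in> Ls. p \<in> T L}" "\<And>p. p \<in> A \<Longrightarrow> card (X p) = k"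
    by blast+
  define R where "R = Sigma A X"
  have finX: "finite (X p)" if "p \<in> A" for p
    using finite_subset[OF X(1)[OF that]] Ls by auto
  have R: "finite R" unfolding R_def using A(1) finX by auto
  have "\<exists>a. a (fst \<rho>) = 1 \<and> (\<forall>j. a j \<noteq> 0 \<longrightarrow> j \<in> T (snd \<rho>)) \<and>
      (\<forall>f. polyfun d D f \<longrightarrow> (\<Sum>j\<in>A. a j * f j) = 0)" if "\<rho> \<in> R" for \<rho>
  proof -
    obtain p M where \<rho>: "\<rho> = (p, M)" "p \<in> A" "M \<in> Ls" "p \<in> T M"
      using \<open>\<rho> \<in> R\<close> X(1) by (auto simp: R_def)
    have "Suc D \<le> card (T M \<inter> A - {p})"
      using L(5)[OF \<rho>(3)] L(3)[OF \<rho>(3)] \<rho>(2,4) by (simp add: D_def card_Diff_singleton)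
    then obtain S where S: "S \<subseteq> T M \<inter> A - {p}" "card S = Suc D" "finite S"
      by (rule obtain_subset_with_card_n)
    have "S \<subseteq> M" "p \<in> M" using S(1) L(2)[OF \<rho>(3)] \<rho>(4) by auto
    from line_relation[OF L(1)[OF \<rho>(3)] this(1) S(3,2) this(2)] obtain b where
      b: "\<And>f. polyfun d D f \<Longrightarrow> f p = (\<Sum>s\<in>S. b s * f s)" by blast
    define a where "a = (\<lambda>j. if j = p then 1 else if j \<in> S then - b j else 0)"
    have "(\<Sum>j\<in>A. a j * f j) = 0" if "polyfun d D f" for f
    proof -
      have "(\<Sum>j\<in>A. a j * f j) = (\<Sum>j\<in>insert p S. a j * f j)"
        using A(1) S(1) \<rho>(2) by (intro sum.mono_neutral_right) (auto simp: a_def)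
      also have "\<dots> = f p + (\<Sum>j\<in>S. a j * f j)"
        using S(1,3) by (subst sum.insert) (auto simp: a_def)
      also have "(\<Sum>j\<in>S. a j * f j) = (\<Sum>j\<in>S. - (b j * f j))"
        using S(1) by (intro sum.cong) (auto simp: a_def)
      also have "\<dots> = - f p" using b[OF that] by (simp add: sum_negf)
      finally show ?thesis by simp
    qed
    moreover have "a p = 1" "\<forall>j. a j \<noteq> 0 \<longrightarrow> j \<in> T M"
      using S(1) \<rho>(4) by (auto simp: a_def)
    ultimately show ?thesis unfolding \<rho>(1) fst_conv snd_conv by blast
  qed
  then obtain a where a_diag: "\<And>\<rho>. \<rho> \<in> R \<Longrightarrow> a \<rho> (fst \<rho>) = 1"
    and a_supp: "\<And>\<rho> j. \<rho> \<in> R \<Longrightarrow> a \<rho> j \<noteq> 0 \<Longrightarrow> j \<in> T (snd \<rho>)"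
    and a_rel: "\<And>\<rho> f. \<rho> \<in> R \<Longrightarrow> polyfun d D f \<Longrightarrow> (\<Sum>j\<in>A. a \<rho> j * f j) = 0"
    by metis
  define \<Phi> where "\<Phi> = (\<lambda>n (x :: complex vec). \<Prod>i<d. x $ i ^ (n div (e + 1) ^ i mod (e + 1)))"
  have \<Phi>: "polyfun d D (\<Phi> n)" for n
    unfolding \<Phi>_def D_def by (rule polyfun_monomial) (auto simp: less_Suc_eq_le[symmetric])
  have fiber: "card {\<rho> \<in> R. fst \<rho> = j} = k" if "j \<in> A" for j
  proof -
    have "{\<rho> \<in> R. fst \<rho> = j} = Pair j ` X j" using that by (auto simp: R_def)
    then show ?thesis using X(2)[OF that] by (simp add: card_image inj_on_def)
  qed
  have R_line: "snd \<rho> \<in> Ls" "fst \<rho> \<in> T (snd \<rho>)" if "\<rho> \<in> R" for \<rho>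
    using that X(1)[of "fst \<rho>"] by (auto simp: R_def)
  have pair: "card {\<rho> \<in> R. a \<rho> i \<noteq> 0 \<and> a \<rho> j \<noteq> 0} \<le> r" if "i \<noteq> j" for i j
  proof (cases "{\<rho> \<in> R. a \<rho> i \<noteq> 0 \<and> a \<rho> j \<noteq> 0} = {}")
    case False
    then obtain \<rho>\<^sub>0 where \<rho>\<^sub>0: "\<rho>\<^sub>0 \<in> R" "a \<rho>\<^sub>0 i \<noteq> 0" "a \<rho>\<^sub>0 j \<noteq> 0" by blast
    let ?M = "snd \<rho>\<^sub>0"
    have M: "?M \<in> Ls" by (rule R_line[OF \<rho>\<^sub>0(1)])
    have ij: "i \<in> ?M" "j \<in> ?M" using a_supp[OF \<rho>\<^sub>0(1)] \<rho>\<^sub>0(2,3) L(2)[OF M] by auto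
    \<comment> \<open>Two distinct points determine their line, so all rows meeting both columns
      belong to \<open>?M\<close> and differ only in their point, which ranges over
      \<open>T ?M\<close>.\<close>
    have "snd \<rho> = ?M" if "\<rho> \<in> R" "a \<rho> i \<noteq> 0" "a \<rho> j \<noteq> 0" for \<rho>
    proof (rule line_unique[OF L(1) L(1) \<open>i \<noteq> j\<close>])
      show "snd \<rho> \<in> Ls" "?M \<in> Ls" using R_line that \<rho>\<^sub>0 by auto
      then show "i \<in> snd \<rho>" "j \<in> snd \<rho>" using a_supp that L(2) by blast+
    qed (use ij in auto)
    then have "{\<rho> \<in> R. a \<rho> i \<noteq> 0 \<and> a \<rho> j \<noteq> 0} \<subseteq> (\<lambda>p. (p, ?M)) ` T ?M"
      using R_line(2) by force
    then have "card {\<rho> \<in> R. a \<rho> i \<noteq> 0 \<and> a \<rho> j \<noteq> 0} \<le> card ((\<lambda>p. (p, ?M)) ` T ?M)"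
      using L(3)[OF M] by (intro card_mono) auto
    also have "\<dots> \<le> card (T ?M)" using L(3)[OF M] by (rule card_image_le)
    finally show ?thesis using L(4)[OF M] by simp
  qed (simp only: card.empty zero_le)
  have "\<not> (\<forall>c n. (\<forall>j\<in>A. (\<Sum>l<(e + 1) ^ d. c l * \<Phi> l j) = 0) \<longrightarrow> n < (e + 1) ^ d \<longrightarrow> c n = 0)"
  proof
    assume indep: "\<forall>c n. (\<forall>j\<in>A. (\<Sum>l<(e + 1) ^ d. c l * \<Phi> l j) = 0) \<longrightarrow> n < (e + 1) ^ d \<longrightarrow> c n = 0"
    have "(e + 1) ^ d * k \<le> r * card A"
    proof (rule design_rank_bound[where a = a and \<pi> = fst and \<Phi> = \<Phi>, OF A(1) R])
      show "fst \<rho> \<in> A" if "\<rho> \<in> R" for \<rho> using that by (auto simp: R_def)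
      show "a \<rho> (fst \<rho>) = 1" if "\<rho> \<in> R" for \<rho> by (rule a_diag[OF that])
      show "card {\<rho> \<in> R. fst \<rho> = j} = k" if "j \<in> A" for j by (rule fiber[OF that])
      show "card {\<rho> \<in> R. a \<rho> i \<noteq> 0 \<and> a \<rho> j \<noteq> 0} \<le> r" if "i \<noteq> j" for i j by (rule pair[OF that])
      show "c n = 0" if "\<And>j. j \<in> A \<Longrightarrow> (\<Sum>l<(e + 1) ^ d. c l * \<Phi> l j) = 0" "n < (e + 1) ^ d" for c n
        using indep that by blast
      show "(\<Sum>j\<in>A. a \<rho> j * \<Phi> i j) = 0" if "\<rho> \<in> R" for \<rho> i by (rule a_rel[OF that \<Phi>])
    qed
    then show False using large by simp
  qed
  then obtain c n where c: "\<And>j. j \<in> A \<Longrightarrow> (\<Sum>l<(e + 1) ^ d. c l * \<Phi> l j) = 0"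
    and n: "n < (e + 1) ^ d" "c n \<noteq> 0" by blast
  define f where "f = (\<lambda>x. \<Sum>l<(e + 1) ^ d. c l * \<Phi> l x)"
  have f: "polyfun d D f" unfolding f_def by (intro polyfun_sum polyfun_scale \<Phi>) simp
  obtain x where x: "x \<in> carrier_vec d" "f x \<noteq> 0"
    using monomials_independent[where B = "e + 1" and d = d and c = c and n = n] n
    unfolding f_def \<Phi>_def by blast
  obtain D' g G p where D': "D' \<le> D" and g: "polyfun d D' g" "\<And>a. a \<in> A \<Longrightarrow> g a = 0"
    and G: "has_gradient d g G" and p: "p \<in> A" "\<exists>i<d. G i p \<noteq> 0"
    using vanishing_polyfun_regular_point[OF A(2,3) f _ x] c unfolding f_def by blast
  let ?F = "{x \<in> carrier_vec d. (\<Sum>i<d. (x $ i - p $ i) * G i p) = 0}"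
  have "is_flat d (d - 1) ?F"
    using hyperplane_is_flat[of p d "\<lambda>i. G i p"] p A(2) by blast
  moreover have "M \<subseteq> ?F" if M: "M \<in> Ls" "p \<in> T M" for M
  proof -
    have "g x = 0" if "x \<in> M" for x
    proof (rule polyfun_vanishes_on_line[OF L(1)[OF M(1)] g(1) _ _ _ that, of "T M \<inter> A"])
      show "D' < card (T M \<inter> A)" using L(5)[OF M(1)] D' by (simp add: D_def)
    qed (use g(2) L(2)[OF M(1)] in auto)
    then have "(\<Sum>i<d. (x $ i - p $ i) * G i p) = 0" if "x \<in> M" for x
      using gradient_orthogonal_to_line[OF L(1)[OF M(1)] _ G _ that] M L(2)[OF M(1)] by blast
    then show ?thesis using line_subset_carrier[OF L(1)[OF M(1)]] by blast
  qed
  ultimately show thesis using that p(1) by blast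
qed

section \<open>Dense subconfigurations and the hyperplane with many points\<close>

lemma incidence_refinement:
  fixes T :: "'l \<Rightarrow> 'p set" and a b :: real
  assumes V: "finite V" and Ls: "finite Ls" and T: "\<And>L. L \<in> Ls \<Longrightarrow> T L \<subseteq> V"
    and large: "a * real (card V) + b * real (card Ls) < (\<Sum>L\<in>Ls. real (card (T L)))" and b: "b \<ge> 0"
  obtains A B where "A \<subseteq> V" "B \<subseteq> Ls" "A \<noteq> {}"
    "\<And>p. p \<in> A \<Longrightarrow> a \<le> real (card {L \<in> B. p \<in> T L})"
    "\<And>L. L \<in> B \<Longrightarrow> b \<le> real (card (T L \<inter> A))"
proof -
  \<comment> \<open>A maximiser of this weight replaces repeated deletion: removing a point costs
    its incidences and gains \<open>a\<close>, removing a line costs its incidences and gains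
    \<open>b\<close>, so neither count can be below its threshold.\<close>
  define \<Psi> where "\<Psi> = (\<lambda>(A, B). (\<Sum>L\<in>B. real (card (T L \<inter> A))) - a * real (card A) - b * real (card B))"
  obtain A B where AB: "A \<subseteq> V" "B \<subseteq> Ls"
    and max: "\<And>A' B'. A' \<subseteq> V \<Longrightarrow> B' \<subseteq> Ls \<Longrightarrow> \<Psi> (A', B') \<le> \<Psi> (A, B)"
  proof -
    have "finite (Pow V \<times> Pow Ls)" "Pow V \<times> Pow Ls \<noteq> {}" using V Ls by auto
    then obtain A B where "is_arg_min (\<lambda>x. - \<Psi> x) (\<lambda>x. x \<in> Pow V \<times> Pow Ls) (A, B)"
      using ex_is_arg_min_if_finite by (metis surj_pair)
    then have AB: "A \<subseteq> V" "B \<subseteq> Ls"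
      and "\<And>A' B'. A' \<subseteq> V \<Longrightarrow> B' \<subseteq> Ls \<Longrightarrow> \<not> - \<Psi> (A', B') < - \<Psi> (A, B)"
      unfolding is_arg_min_def by blast+
    then show thesis by (intro that[OF AB]) (meson neg_less_iff_less not_less)
  qed
  have fin: "finite A" "finite B" using AB V Ls finite_subset by auto
  have "(\<Sum>L\<in>Ls. real (card (T L \<inter> V))) = (\<Sum>L\<in>Ls. real (card (T L)))"
    using T by (intro sum.cong) (auto simp: Int_absorb2)
  then have pos: "\<Psi> (A, B) > 0" using max[of V Ls] large by (simp add: \<Psi>_def)
  \<comment> \<open>For empty \<open>A\<close> only \<open>- b * card B\<close> would remain, which
    is not positive.\<close>
  have "A \<noteq> {}" using pos b by (auto simp: \<Psi>_def mult_less_0_iff)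
  moreover have "a \<le> real (card {L \<in> B. p \<in> T L})" if p: "p \<in> A" for p
  proof -
    have "(\<Sum>L\<in>B. real (card (T L \<inter> A))) =
        (\<Sum>L\<in>B. real (card (T L \<inter> (A - {p}))) + (if p \<in> T L then 1 else 0))"
    proof (intro sum.cong refl)
      fix L
      have "card (T L \<inter> A) = Suc (card (T L \<inter> (A - {p})))" if "p \<in> T L"
      proof -
        have "T L \<inter> A = insert p (T L \<inter> (A - {p}))" using that p by auto
        then show ?thesis using fin(1) by (metis Diff_iff IntD2 card_insert_disjoint finite_Diff finite_Int singletonI)
      qed
      moreover have "T L \<inter> A = T L \<inter> (A - {p})" if "p \<notin> T L" using that by auto
      ultimately show "real (card (T L \<inter> A)) = real (card (T L \<inter> (A - {p}))) + (if p \<in> T L then 1 else 0)"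
        by auto
    qed
    also have "\<dots> = (\<Sum>L\<in>B. real (card (T L \<inter> (A - {p})))) + real (card {L \<in> B. p \<in> T L})"
      using fin(2) by (simp add: sum.distrib flip: sum.inter_filter)
    finally have "(\<Sum>L\<in>B. real (card (T L \<inter> A))) =
      (\<Sum>L\<in>B. real (card (T L \<inter> (A - {p})))) + real (card {L \<in> B. p \<in> T L})" .
    moreover have "card A = Suc (card (A - {p}))" using fin(1) p by (rule card.remove)
    moreover have "\<Psi> (A - {p}, B) \<le> \<Psi> (A, B)" using AB by (intro max) auto
    ultimately show ?thesis by (simp add: \<Psi>_def algebra_simps)
  qed
  moreover have "b \<le> real (card (T L \<inter> A))" if L: "L \<in> B" for L
  proof -
    have "card B = Suc (card (B - {L}))" using fin(2) L by (metis card.remove)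
    then show ?thesis
      using max[of A "B - {L}"] AB L fin by (auto simp: \<Psi>_def sum.remove algebra_simps)
  qed
  ultimately show thesis using that AB by blast
qed

text \<open>A rich line is recovered from an ordered pair of its points in \<open>V\<close>. The
  resulting quadratic bound is what later excludes small \<open>r\<close>.\<close>

lemma finite_rich_lines:
  assumes V: "finite V" and r: "r \<ge> 2"
  shows "finite (rich_lines d r V)" "card (rich_lines d r V) \<le> card V ^ 2"
proof -
  let ?l = "\<lambda>(x, y). {x + t \<cdot>\<^sub>v (y - x) |t. True}"
  have sub: "rich_lines d r V \<subseteq> ?l ` (V \<times> V)"
  proof
    fix L assume "L \<in> rich_lines d r V"
    then have L: "is_flat d 1 L" "r \<le> card (L \<inter> V)" by (auto simp: rich_lines_def)
    then obtain x y where xy: "x \<in> L \<inter> V" "y \<in> L \<inter> V" "x \<noteq> y"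
      using r by (metis card_le_Suc0_iff_eq card.infinite not_less_eq_eq numeral_2_eq_2 order.trans zero_le)
    then have "L = ?l (x, y)" using line_through[OF L(1)] by auto
    then show "L \<in> ?l ` (V \<times> V)" using xy by blast
  qed
  have fin: "finite (V \<times> V)" using V by simp
  show "finite (rich_lines d r V)" using sub fin finite_surj by blast
  have "card (rich_lines d r V) \<le> card (V \<times> V)" using fin sub by (rule surj_card_le)
  then show "card (rich_lines d r V) \<le> card V ^ 2" by (simp add: card_cartesian_product power2_eq_square)
qed

lemma hyperplane_exists: "d \<ge> 1 \<Longrightarrow> \<exists>F. is_flat d (d - 1) F"
  by (rule exI, rule hyperplane_is_flat[of "0\<^sub>v d" d "\<lambda>_. 1"]) (auto intro: exI[of _ 0])

lemma many_rich_lines_hyperplane: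
  assumes d: "d \<ge> 1" and V: "V \<subseteq> carrier_vec d" "finite V" "V \<noteq> {}" and r: "r \<ge> 2"
    and C: "C > 16 ^ d" "C > 4 * (8 * real d) ^ d"
    and m: "real (card (rich_lines d r V)) \<ge> C * (real (card V) ^ 2 / real r ^ d)"
  obtains F where "is_flat d (d - 1) F"
    "real (card (V \<inter> F)) \<ge> real r ^ 2 * real (card (rich_lines d r V)) / (8 * real (card V))"
proof -
  define n where "n = card V"
  define m where "m = card (rich_lines d r V)"
  have n: "n > 0" using V(2,3) by (simp add: n_def card_gt_0_iff)
  have m_ge: "real m \<ge> C * (real n ^ 2 / real r ^ d)" using m by (simp add: m_def n_def)
  have C0: "C > 0" using C(1) zero_le_power[of "16 :: real" d] by linarith
  have m_pos: "m > 0"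
  proof -
    have "0 < C * (real n ^ 2 / real r ^ d)" using C0 n r by simp
    then show ?thesis using m_ge by linarith
  qed
  \<comment> \<open>For smaller \<open>r\<close> the hypothesis would force more than
    \<open>n\<^sup>2\<close> rich lines, as \<open>C > 16 ^ d\<close>. The bound keeps the
    subtraction in \<open>r div 4 - 2\<close> from truncating.\<close>
  have r16: "r \<ge> 16"
  proof (rule ccontr)
    assume "\<not> r \<ge> 16"
    then have "real r ^ d \<le> 16 ^ d" by (intro power_mono) auto
    also have "\<dots> < C" by (rule C)
    finally have "real r ^ d < C" .
    then have "real n ^ 2 * real r ^ d < C * real n ^ 2" using n by simp
    then have "real n ^ 2 < C * (real n ^ 2 / real r ^ d)" using r by (simp add: pos_less_divide_eq)
    moreover have "real m \<le> real n ^ 2"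
      using of_nat_mono[OF finite_rich_lines(2)[OF V(2) r, of d], where 'a = real] by (simp add: m_def n_def)
    ultimately show False using m_ge by linarith
  qed
  have "\<forall>L\<in>rich_lines d r V. \<exists>X. X \<subseteq> L \<inter> V \<and> card X = r"
  proof
    fix L assume "L \<in> rich_lines d r V"
    then have "r \<le> card (L \<inter> V)" by (simp add: rich_lines_def)
    then show "\<exists>X. X \<subseteq> L \<inter> V \<and> card X = r" by (rule obtain_subset_with_card_n) blast
  qed
  then obtain T where "\<forall>L\<in>rich_lines d r V. T L \<subseteq> L \<inter> V \<and> card (T L) = r"
    by (elim bchoice[THEN exE])
  then have T: "\<And>L. L \<in> rich_lines d r V \<Longrightarrow> T L \<subseteq> L \<inter> V" "\<And>L. L \<in> rich_lines d r V \<Longrightarrow> card (T L) = r"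
    by blast+
  have T_fin: "finite (T L)" if "L \<in> rich_lines d r V" for L
    using T(1)[OF that] V(2) finite_subset by auto
  \<comment> \<open>A quarter of the average number \<open>r * m / n\<close> of marked incidences
    per point. The thresholds \<open>a\<close> and \<open>r / 4\<close> together use half of the
    \<open>r * m\<close> incidences, which leaves a positive weight.\<close>
  define a where "a = real r * real m / (4 * real n)"
  have TV: "T L \<subseteq> V" if "L \<in> rich_lines d r V" for L using T(1)[OF that] by auto
  have "a * real (card V) + real r / 4 * real (card (rich_lines d r V)) = real r * real m / 2"
    using n by (simp add: a_def n_def m_def)
  also have "\<dots> < real r * real m" using r m_pos by simp
  also have "\<dots> = (\<Sum>L\<in>rich_lines d r V. real (card (T L)))"
    using T(2) by (simp add: m_def)
  finally have large: "a * real (card V) + real r / 4 * real (card (rich_lines d r V)) <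
      (\<Sum>L\<in>rich_lines d r V. real (card (T L)))" .
  obtain A B where A: "A \<subseteq> V" "A \<noteq> {}" and B: "B \<subseteq> rich_lines d r V"
    and A_deg: "\<And>p. p \<in> A \<Longrightarrow> a \<le> real (card {L \<in> B. p \<in> T L})"
    and B_deg: "\<And>L. L \<in> B \<Longrightarrow> real r / 4 \<le> real (card (T L \<inter> A))"
    by (rule incidence_refinement[OF V(2) finite_rich_lines(1)[OF V(2) r] TV large])
      (assumption | rule that | simp)+
  have finB: "finite B" using B finite_rich_lines(1)[OF V(2) r] by (rule finite_subset)
  have B_flat: "is_flat d 1 L" if "L \<in> B" for L using B that by (auto simp: rich_lines_def)
  \<comment> \<open>The largest \<open>e\<close> with \<open>d * e + 2 \<le> r div 4\<close>, the
    number of points of \<open>A\<close> guaranteed on each line of \<open>B\<close>.\<close>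
  define e where "e = (r div 4 - 2) div d"
  define k where "k = nat \<lceil>a\<rceil>"
  have "real (r * card A) < real ((e + 1) ^ d * k)"
  proof -
    have "r div 4 - 2 < d * (e + 1)"
      using dividend_less_times_div[of d "r div 4 - 2"] d by (simp add: e_def)
    then have "r \<le> 8 * d * (e + 1)" using r16 by linarith
    then have "real r \<le> real (8 * d * (e + 1))" by (rule of_nat_mono)
    also have "\<dots> = 8 * real d * real (e + 1)" by (simp add: algebra_simps)
    finally have "real r ^ d \<le> (8 * real d * real (e + 1)) ^ d" by (intro power_mono) simp_all
    then have re: "real r ^ d \<le> (8 * real d) ^ d * real (e + 1) ^ d" by (simp only: power_mult_distrib)
    \<comment> \<open>This chain is the hypothesis on \<open>C\<close> in the form
      \<open>r n < (r / (8 d))^d a\<close>, after clearing denominators; \<open>re\<close> replaces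
      \<open>r / (8 d)\<close> by \<open>e + 1\<close>.\<close>
    have "real r * real n * (4 * (8 * real d) ^ d) < real r * real n * C"
      using C(2) r n by simp
    also have "\<dots> = real r ^ d * (real r * (C * (real n ^ 2 / real r ^ d)) / real n)"
      using r n by (simp add: power2_eq_square)
    also have "\<dots> \<le> real r ^ d * (real r * real m / real n)"
      using m_ge by (intro mult_left_mono divide_right_mono) auto
    also have "\<dots> = 4 * (real r ^ d * a)" by (simp add: a_def)
    also have "\<dots> \<le> 4 * (((8 * real d) ^ d * real (e + 1) ^ d) * real k)"
      using re by (intro mult_left_mono mult_mono) (auto simp: a_def k_def real_nat_ceiling_ge)
    finally have "(4 * (8 * real d) ^ d) * (real r * real n) < (4 * (8 * real d) ^ d) * (real (e + 1) ^ d * real k)"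
      by (simp add: ac_simps)
    then have "real r * real n < real (e + 1) ^ d * real k"
      using d by (subst (asm) mult_less_cancel_left_pos) auto
    moreover have "real (card A) \<le> real n" using card_mono[OF V(2) A(1)] by (simp add: n_def)
    then have "real r * real (card A) \<le> real r * real n" by (rule mult_left_mono) simp
    ultimately show ?thesis by simp
  qed
  then have large': "r * card A < (e + 1) ^ d * k" by (simp only: of_nat_less_iff)
  have B_card: "d * e + 2 \<le> card (T L \<inter> A)" if "L \<in> B" for L
  proof -
    have "r div 4 \<le> card (T L \<inter> A)" using B_deg[OF that] by linarith
    moreover have "d * e \<le> r div 4 - 2" by (simp add: e_def)
    ultimately show ?thesis using r16 by linarith
  qed
  have k_le: "k \<le> card {L \<in> B. p \<in> T L}" if "p \<in> A" for p
    using A_deg[OF that] by (simp add: k_def nat_ceiling_le_eq)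
  obtain p F where p: "p \<in> A" and F: "is_flat d (d - 1) F"
    and pF: "\<And>L. L \<in> B \<Longrightarrow> p \<in> T L \<Longrightarrow> L \<subseteq> F"
  proof (rule lines_through_regular_point_coplanar[where Ls = B and T = T and A = A, OF _ _ A(2) finB B_flat
        _ _ _ B_card k_le large'])
    show "finite A" "A \<subseteq> carrier_vec d" using A(1) V finite_subset by auto
    show "T L \<subseteq> L" "finite (T L)" "card (T L) \<le> r" if "L \<in> B" for L
      using T T_fin B that by auto
  qed (assumption | rule that)+
  \<comment> \<open>Distinct lines through \<open>p\<close> share no other point, so their remaining
    \<open>r - 1\<close> marked points can be added up without overlap.\<close>
  define Bp where "Bp = {L \<in> B. p \<in> T L}"
  have "card (\<Union>L\<in>Bp. T L - {p}) = (\<Sum>L\<in>Bp. card (T L - {p}))"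
  proof (rule card_UN_disjoint)
    show "\<forall>L\<in>Bp. \<forall>M\<in>Bp. L \<noteq> M \<longrightarrow> (T L - {p}) \<inter> (T M - {p}) = {}"
    proof (intro ballI impI)
      fix L M assume L: "L \<in> Bp" and M: "M \<in> Bp" and "L \<noteq> M"
      have "x = p" if "x \<in> T L" "x \<in> T M" for x
      proof (rule ccontr)
        assume "x \<noteq> p"
        have "L = M"
          by (rule line_unique[OF B_flat B_flat \<open>x \<noteq> p\<close>]) (use L M that T(1) B in \<open>auto simp: Bp_def\<close>)
        then show False using \<open>L \<noteq> M\<close> by blast
      qed
      then show "(T L - {p}) \<inter> (T M - {p}) = {}" by blast
    qed
  qed (use finB B T_fin in \<open>auto simp: Bp_def\<close>)
  also have "\<dots> = (\<Sum>L\<in>Bp. r - 1)"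
    by (rule sum.cong) (use T(2) T_fin B in \<open>auto simp: Bp_def card_Diff_singleton\<close>)
  also have "\<dots> = card Bp * (r - 1)" by simp
  finally have "card Bp * (r - 1) = card (\<Union>L\<in>Bp. T L - {p})" ..
  also have "\<dots> \<le> card (V \<inter> F)"
  proof (rule card_mono)
    show "(\<Union>L\<in>Bp. T L - {p}) \<subseteq> V \<inter> F"
      using T(1) B pF by (fastforce simp: Bp_def)
  qed (use V(2) in simp)
  finally have cnt: "card Bp * (r - 1) \<le> card (V \<inter> F)" .
  have "real r ^ 2 * real m / (8 * real n) = a * (real r / 2)"
    by (simp add: a_def power2_eq_square)
  \<comment> \<open>Uses \<open>r - 1 \<ge> r / 2\<close>, valid because \<open>r \<ge> 2\<close>;
    with the 4 in \<open>a\<close> this gives the denominator 8.\<close>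
  also have "\<dots> \<le> real (card Bp) * real (r - 1)"
    using A_deg[OF p] r by (intro mult_mono) (auto simp: Bp_def)
  also have "\<dots> \<le> real (card (V \<inter> F))" using of_nat_mono[OF cnt, where 'a = real] by simp
  finally show thesis using that[OF F] by (simp add: m_def n_def)
qed

section \<open>Passing to admissible constants\<close>

lemma rich_lines_constants_large:
  assumes d: "d \<ge> 1" and C: "C > 16 ^ d" "C > 4 * (8 * real d) ^ d" and C': "C' \<le> C / 8"
  shows "rich_lines_constants d C C'"
  unfolding rich_lines_constants_def
proof (intro allI impI, elim conjE)
  fix V :: "complex vec set" and n r :: nat and \<alpha> :: real
  assume V: "V \<subseteq> carrier_vec d" "finite V" and n: "card V = n" and r: "r \<ge> 2" and \<alpha>: "\<alpha> \<ge> 1"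
    and m: "real (card (rich_lines d r V)) \<ge> C * \<alpha> * (real n ^ 2 / real r ^ d)"
  show "\<exists>V'\<subseteq>V. real (card V') \<ge> C' * \<alpha> * (real n / real r powi (int d - 2)) \<and>
      (\<exists>F. is_flat d (d - 1) F \<and> V' \<subseteq> F)"
  proof (cases "V = {}")
    case True
    then have "n = 0" using n by simp
    then show ?thesis using hyperplane_exists[OF d] by auto
  next
    case False
    then have n0: "n > 0" using n V(2) by (auto simp: card_gt_0_iff)
    have C0: "C > 0" using C(1) zero_le_power[of "16 :: real" d] by linarith
    have "C * 1 * (real n ^ 2 / real r ^ d) \<le> C * \<alpha> * (real n ^ 2 / real r ^ d)"
      using C0 \<alpha> by (intro mult_right_mono mult_left_mono) auto
    then have "real (card (rich_lines d r V)) \<ge> C * (real (card V) ^ 2 / real r ^ d)" using m n by simp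
    from many_rich_lines_hyperplane[OF d V False r C this] obtain F where F: "is_flat d (d - 1) F"
      and cF: "real (card (V \<inter> F)) \<ge> real r ^ 2 * real (card (rich_lines d r V)) / (8 * real n)"
      using n by blast
    \<comment> \<open>The integer exponent makes this valid for \<open>d = 1\<close> too, where it
      is -1.\<close>
    have powi: "real r powi (int d - 2) = real r ^ d / real r ^ 2"
      using r by (simp add: power_int_diff)
    have "C' * \<alpha> * (real n / real r powi (int d - 2)) \<le> C / 8 * \<alpha> * (real n / real r powi (int d - 2))"
      using C' \<alpha> by (intro mult_right_mono) auto
    also have "\<dots> = real r ^ 2 * (C * \<alpha> * (real n ^ 2 / real r ^ d)) / (8 * real n)"
      using n0 by (simp add: powi power2_eq_square field_simps)
    also have "\<dots> \<le> real r ^ 2 * real (card (rich_lines d r V)) / (8 * real n)"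
      using m by (intro divide_right_mono mult_left_mono) auto
    also note cF
    finally show ?thesis using F by blast
  qed
qed

text \<open>In dimension 1 the constants \<open>d powr (c * d)\<close> are 1, so this case cannot rely on large constants.\<close>
lemma rich_lines_constants_1: "rich_lines_constants 1 1 1"
  unfolding rich_lines_constants_def
proof (intro allI impI, elim conjE)
  fix V :: "complex vec set" and n r :: nat and \<alpha> :: real
  assume V: "V \<subseteq> carrier_vec 1" "finite V" and n: "card V = n" and r: "r \<ge> 2" and \<alpha>: "\<alpha> \<ge> 1"
    and m: "real (card (rich_lines 1 r V)) \<ge> 1 * \<alpha> * (real n ^ 2 / real r ^ 1)"
  \<comment> \<open>There is only one line in dimension 1, namely the whole space. If
    \<open>n > 0\<close>, the hypothesis makes it rich, so \<open>r \<le> n\<close> and 1 \<ge> n^2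
    / r \<ge> n \<ge> r \<ge> 2, a contradiction.\<close>
  have "n = 0"
  proof (rule ccontr)
    assume "n \<noteq> 0"
    have sub: "rich_lines 1 r V \<subseteq> {carrier_vec 1}"
    proof
      fix L assume "L \<in> rich_lines 1 r V"
      then have "is_flat 1 1 L" by (simp add: rich_lines_def)
      then obtain p w where pw: "p \<in> carrier_vec 1" "w \<in> carrier_vec 1" "w \<noteq> 0\<^sub>v 1"
        and L: "L = {p + t \<cdot>\<^sub>v w |t. True}" by (rule is_flat_1_line)
      have "w $ 0 \<noteq> 0" using pw(2,3) by (auto simp: vec_eq_iff)
      have "x = p + ((x $ 0 - p $ 0) / w $ 0) \<cdot>\<^sub>v w" if "x \<in> carrier_vec 1" for x
        using pw that \<open>w $ 0 \<noteq> 0\<close> by (intro eq_vecI) auto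
      then have "L = carrier_vec 1" using L pw by auto
      then show "L \<in> {carrier_vec 1}" by simp
    qed
    then have m1: "card (rich_lines 1 r V) \<le> 1" using card_mono[OF _ sub] by simp
    have "0 < 1 * \<alpha> * (real n ^ 2 / real r ^ 1)" using \<alpha> r \<open>n \<noteq> 0\<close> by simp
    then have "rich_lines 1 r V \<noteq> {}" using m by auto
    then obtain L where "r \<le> card (L \<inter> V)" by (auto simp: rich_lines_def)
    also have "\<dots> \<le> n" using card_mono[OF V(2), of "L \<inter> V"] n by simp
    finally have "r \<le> n" .
    then have "real n \<le> real n ^ 2 / real r"
      using r by (simp add: pos_le_divide_eq power2_eq_square)
    also have "\<dots> \<le> \<alpha> * (real n ^ 2 / real r)" using mult_right_mono[OF \<alpha>, of "real n ^ 2 / real r"] by simp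
    finally show False using m m1 r \<open>r \<le> n\<close> by simp
  qed
  then show "\<exists>V'\<subseteq>V. real (card V') \<ge> 1 * \<alpha> * (real n / real r powi (int 1 - 2)) \<and>
      (\<exists>F. is_flat 1 (1 - 1) F \<and> V' \<subseteq> F)"
    using hyperplane_exists[of 1] by (intro exI[of _ "{}"]) auto
qed

text \<open>For \<open>d \<ge> 2\<close> the power d^(4d) dominates both 16^d and (8 d)^d, as d^4
  \<ge> 16 and d^3 \<ge> 8. The extra factor d^(2d) \<ge> 16 pays for the factors 4 and 8 in the
  conditions on \<open>C\<close> and \<open>C'\<close>; hence the exponents 6 and 4.\<close>

lemma rich_lines_constants_powr:
  assumes d: "d \<ge> 1"
  shows "rich_lines_constants d (real d powr (6 * real d)) (real d powr (4 * real d))"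
proof (cases "d = 1")
  case True
  then show ?thesis using rich_lines_constants_1 by simp
next
  case False
  with d have d2: "real d \<ge> 2" by simp
  define x where "x = real d ^ (4 * d)"
  define y where "y = real d ^ (2 * d)"
  have C: "real d powr (6 * real d) = y * x" and C': "real d powr (4 * real d) = x"
    using d powr_realpow[of "real d" "6 * d"] powr_realpow[of "real d" "4 * d"]
    by (simp_all add: x_def y_def flip: power_add)
  have x0: "x > 0" using d2 by (simp add: x_def)
  have "(2 :: real) ^ (2 * 2) \<le> 2 ^ (2 * d)" using d2 by (intro power_increasing) auto
  also have "\<dots> \<le> y" unfolding y_def using d2 by (intro power_mono) auto
  finally have y: "y \<ge> 16" by simp
  have d3: "real d ^ 3 \<ge> 2 ^ 3" using d2 by (intro power_mono) auto
  have d4: "real d ^ 4 \<ge> 2 ^ 4" using d2 by (intro power_mono) auto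
  have "16 ^ d \<le> (real d ^ 4) ^ d" using d4 by (intro power_mono) auto
  then have a: "16 ^ d \<le> x" by (simp add: x_def power_mult)
  have "8 * real d \<le> real d ^ 4" using mult_right_mono[OF d3, of "real d"] by (simp add: power4_eq_xxxx power3_eq_cube)
  then have "(8 * real d) ^ d \<le> (real d ^ 4) ^ d" by (intro power_mono) auto
  then have b: "(8 * real d) ^ d \<le> x" by (simp add: x_def power_mult)
  have yx: "16 * x \<le> y * x" using y x0 by (intro mult_right_mono) auto
  show ?thesis
    unfolding C C' by (rule rich_lines_constants_large[OF d]) (use a b x0 yx in linarith)+
qed

theorem theorem1:
  shows "(\<forall>d\<ge>1. \<exists>C>0. \<exists>C'>0. rich_lines_constants d C C') \<and>
    (\<exists>c>0. \<exists>c'>0. \<forall>d\<ge>1.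
       rich_lines_constants d (real d powr (c * real d)) (real d powr (c' * real d)))"
proof (intro conjI allI impI)
  fix d :: nat assume d: "d \<ge> 1"
  then have "real d powr (6 * real d) > 0" "real d powr (4 * real d) > 0" by simp_all
  then show "\<exists>C>0. \<exists>C'>0. rich_lines_constants d C C'"
    using rich_lines_constants_powr[OF d] by blast
next
  show "\<exists>c>0. \<exists>c'>0. \<forall>d\<ge>1.
      rich_lines_constants d (real d powr (c * real d)) (real d powr (c' * real d))"
    by (rule exI[of _ 6], rule conjI, simp, rule exI[of _ 4])
      (simp add: rich_lines_constants_powr)
qed

end
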